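(* Let $r\ge1$, $\delta\ge2$, let $r\mid k$ and set $t=k/r$. Let $\mathcal{C}$ be an $[n,k,d_{\min}]$ linear code over $\mathbb{F}_q$ which is an optimal code having $(r,\delta)$ information locality, with local codes $\{\mathcal{C}_i\}_{i\in\mathcal{L}}$ having supports $\{S_i\}_{i\in\mathcal{L}}$. Then: (a) for every $i\in\mathcal{L}$, the local code $\mathcal{C}_i$ is an $[r+\delta-1,r,\delta]$ MDS code; (b) the local codes have disjoint supports: $S_i\cap S_j=\emptyset$ for all $i,j\in\mathcal{L}$, $i\ne j$; (c) for any distinct indices $i_1,\dots,i_t\in\mathcal{L}$, $$\dim\Big(V_{i_t}\cap\Big(\sum_{j=1}^{t-1}V_{i_j}\Big)\Big)=0,$$ and, consequently, up to permutation of columns, the $k\times n$ generator matrix $G$ of $\mathcal{C}$ can be expressed in the form $$G=\left[\begin{array}{ccc|c}G_1&&&\\&\ddots&&A\\&&G_t&\end{array}\right],$$ where each $G_i$, $1\le i\le t$, is an $r\times(r+\delta-1)$ generator matrix of an $[r+\delta-1,r,\delta]$ MDS code, the blank off-diagonal blocks are zero, and $A$ is some $k\times(n-t(r+\delta-1))$ matrix.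
   Context: For a linear code $\mathcal{C}$ of length $n$ and dimension $k$ over $\mathbb{F}_q$ with generator matrix $G$, and $S\subseteq[n]$, $G|_S$ is the submatrix of columns indexed by $S$ and $\mathcal{C}|_S$ the code punctured to (restricted to) the coordinates in $S$. The code $\mathcal{C}$ has $(r,\delta)$ information locality if it has a family of punctured codes $\{\mathcal{C}_i=\mathcal{C}|_{S_i}\}_{i\in\mathcal{L}}$ (local codes) with supports $S_i\subseteq[n]$ such that for all $i\in\mathcal{L}$: $|S_i|\le r+\delta-1$, $d_{\min}(\mathcal{C}_i)\ge\delta$, and $\mathrm{Rank}(G|_{\cup_{i\in\mathcal{L}}S_i})=k$. $\mathcal{L}$ is the index set of all the local codes; distinct indices correspond to distinct local codes. A code having $(r,\delta)$ information locality is called optimal if $d_{\min}=n-k+1-(\lceil k/r\rceil-1)(\delta-1)$. For $i\in\mathcal{L}$, $V_i\subseteq\mathbb{F}_q^k$ is the column space of $G|_{S_i}$. An $[a,b,c]$ MDS code is a linear code with $c=a-b+1$.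
   Formalization: Part (b), disjointness of the supports, is stated only for r < k (t ≥ 2), because for r = k it fails: the binary code {000,111} with r = k = 1, δ = 2 and supports {1,2}, {2,3} is optimal but the supports meet. *)

theory Defs
  imports
    "Jordan_Normal_Form.DL_Rank"
    "Jordan_Normal_Form.DL_Submatrix"
    "HOL-Combinatorics.Permutations"
begin

definition subspace_dim :: "nat \<Rightarrow> 'a::field vec set \<Rightarrow> nat" where
  "subspace_dim m W = vectorspace.dim class_ring ((module_vec TYPE('a) m)\<lparr>carrier := W\<rparr>)"

definition subspace_sum_family :: "nat \<Rightarrow> ('j \<Rightarrow> 'a::field vec set) \<Rightarrow> 'j set \<Rightarrow> 'a vec set" where
  "subspace_sum_family m W J = {finsum_vec TYPE('a) m w J | w. \<forall>j\<in>J. w j \<in> W j}"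

definition linear_code :: "nat \<Rightarrow> nat \<Rightarrow> 'a::field vec set \<Rightarrow> bool" where
  "linear_code n k C \<longleftrightarrow>
     VectorSpace.subspace class_ring C (module_vec TYPE('a) n) \<and> subspace_dim n C = k"

definition hamming_dist :: "'a vec \<Rightarrow> 'a vec \<Rightarrow> nat" where
  "hamming_dist x y = card {i. i < dim_vec x \<and> x $ i \<noteq> y $ i}"

text \<open>A code with a single word has no minimum distance; the junk value 0 makes every lower bound
  \<open>min_dist C \<ge> \<delta>\<close> with \<open>\<delta> \<ge> 1\<close> fail for it. Thus a zero code, e.g. one with empty support,
  never counts as a local code.\<close>

definition min_dist :: "'a vec set \<Rightarrow> nat" where
  "min_dist C =
     (if \<exists>x\<in>C. \<exists>y\<in>C. x \<noteq> y
      then LEAST d. \<exists>x\<in>C. \<exists>y\<in>C. x \<noteq> y \<and> hamming_dist x y = d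
      else 0)"

definition mds_code :: "nat \<Rightarrow> nat \<Rightarrow> nat \<Rightarrow> 'a::field vec set \<Rightarrow> bool" where
  "mds_code a b c C \<longleftrightarrow> linear_code a b C \<and> min_dist C = c \<and> int c = int a - int b + 1"

text \<open>Since the row space of the \<open>k \<times> n\<close> matrix has dimension \<open>k\<close>, its rows form a basis of the code.\<close>

definition generator_matrix :: "nat \<Rightarrow> nat \<Rightarrow> 'a::field vec set \<Rightarrow> 'a mat \<Rightarrow> bool" where
  "generator_matrix n k C G \<longleftrightarrow>
     linear_code n k C \<and> G \<in> carrier_mat k n \<and> vec_space.row_space n G = C"

text \<open>Coordinates are numbered from 0. The code is restricted to the coordinates in \<open>S\<close>, taken in
  increasing order, as in \<^const>\<open>submatrix\<close>.\<close>

definition puncture :: "'a vec set \<Rightarrow> nat set \<Rightarrow> 'a vec set" where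
  "puncture C S = (\<lambda>c. vec (card S) (\<lambda>i. c $ pick S i)) ` C"

definition restrict_cols :: "'a mat \<Rightarrow> nat set \<Rightarrow> 'a mat" where
  "restrict_cols G S = submatrix G UNIV S"

definition local_space :: "nat \<Rightarrow> 'a::field mat \<Rightarrow> nat set \<Rightarrow> 'a vec set" where
  "local_space k G S = vec_space.col_space k (restrict_cols G S)"

text \<open>A local code is determined by its support, so distinctness of the local codes is injectivity
  of the family of supports.\<close>

definition info_locality_family ::
  "nat \<Rightarrow> nat \<Rightarrow> nat \<Rightarrow> nat \<Rightarrow> 'a::field vec set \<Rightarrow> 'a mat \<Rightarrow> 'i set \<Rightarrow> ('i \<Rightarrow> nat set) \<Rightarrow> bool" where
  "info_locality_family n k r \<delta> C G L S \<longleftrightarrow>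
     inj_on S L \<and>
     (\<forall>i\<in>L. S i \<subseteq> {..<n} \<and> card (S i) \<le> r + \<delta> - 1 \<and> min_dist (puncture C (S i)) \<ge> \<delta>) \<and>
     vec_space.rank k (restrict_cols G (\<Union>i\<in>L. S i)) = k"

definition optimal_distance :: "nat \<Rightarrow> nat \<Rightarrow> nat \<Rightarrow> nat \<Rightarrow> nat \<Rightarrow> bool" where
  "optimal_distance n k r \<delta> d \<longleftrightarrow>
     int d = int n - int k + 1 - (\<lceil>real k / real r\<rceil> - 1) * (int \<delta> - 1)"

definition permute_cols :: "(nat \<Rightarrow> nat) \<Rightarrow> 'a mat \<Rightarrow> 'a mat" where
  "permute_cols p G = mat (dim_row G) (dim_col G) (\<lambda>(i, j). G $$ (i, p j))"

definition append_cols :: "'a::zero mat \<Rightarrow> 'a mat \<Rightarrow> 'a mat" where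
  "append_cols A B = four_block_mat A B (0\<^sub>m 0 (dim_col A)) (0\<^sub>m 0 (dim_col B))"

end

theory Submission
  imports Defs "HOL-Library.Cardinality"
begin

text \<open>Write \<open>K(T)\<close> for the codewords vanishing on \<open>T\<close>, so that \<open>k - dim K(T)\<close> is the rank of
  the columns in \<open>T\<close>. If \<open>K(T) \<noteq> 0\<close>, then \<open>|T| \<le> n - d\<close>. Adding a local support \<open>S\<^sub>i\<close> that raises the
  rank of \<open>T\<close> raises it by at most \<open>r\<close>, and raises the nullity \<open>|T| - rank T\<close> by at least \<open>\<delta> - 1\<close>.
  Starting from any \<open>T\<close> and adding local supports greedily therefore bounds the nullity of \<open>T\<close> in
  terms of its rank, and optimality of \<open>d\<close> makes this bound tight: it forces every local code to have
  rank \<open>r\<close> and length \<open>r + \<delta> - 1\<close>, two supports to be disjoint if \<open>t \<ge> 2\<close>, and any \<open>t\<close> of them to have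
  full rank. Picking \<open>r\<close> coordinates in each of \<open>t\<close> local supports then gives an information set, and
  the systematic generator matrix for it has the block form. Over a finite field all dimensions can be
  read off from cardinalities.\<close>

subsection \<open>Subspaces over a finite field\<close>

lemma subspace_vec_iff:
  "VectorSpace.subspace class_ring W (module_vec TYPE('a::field) n) \<longleftrightarrow>
   W \<subseteq> carrier_vec n \<and> 0\<^sub>v n \<in> W \<and> (\<forall>x\<in>W. \<forall>y\<in>W. x + y \<in> W) \<and> (\<forall>a. \<forall>x\<in>W. a \<cdot>\<^sub>v x \<in> W)"
proof -
  interpret vec_space "TYPE('a)" n .
  show ?thesis
    unfolding VectorSpace.subspace_def submodule_def
    using module_axioms vectorspace_axioms by auto
qed

text \<open>Coordinates in a finite basis identify \<open>W\<close> with the functions from that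
  basis to the field. Dimension thus becomes a logarithm of cardinality, and later dimension
  identities are proved by counting.\<close>

lemma card_subspace:
  fixes W :: "'a::{field,finite} vec set"
  assumes "VectorSpace.subspace class_ring W (module_vec TYPE('a) n)" "finite W"
  shows "card W = CARD('a) ^ subspace_dim n W"
proof -
  interpret V: vec_space "TYPE('a)" n .
  let ?W = "(module_vec TYPE('a) n)\<lparr>carrier := W\<rparr>"
  interpret W: vectorspace class_ring ?W
    using V.subspace_is_vs[OF assms(1)] by simp
  have "W.fin_dim"
    unfolding W.fin_dim_def
    using assms(2) W.span_is_subset2[of W] W.in_own_span[of W] by (intro exI[of _ W]) auto
  then obtain B where B: "finite B" "W.basis B"
    using W.finite_basis_exists by blast
  have BW: "B \<subseteq> W" using B(2) unfolding W.basis_def by simp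
  have dim: "subspace_dim n W = card B"
    unfolding subspace_dim_def using W.dim_basis[OF B] .
  have ex1: "\<forall>v\<in>W. \<exists>!a. a \<in> B \<rightarrow>\<^sub>E UNIV \<and> W.lincomb a B = v"
    using W.basis_criterion[of B] B BW by simp
  have "bij_betw (\<lambda>a. W.lincomb a B) (B \<rightarrow>\<^sub>E (UNIV :: 'a set)) W"
  proof (rule bij_betwI')
    fix a b assume ab: "a \<in> B \<rightarrow>\<^sub>E (UNIV :: 'a set)" "b \<in> B \<rightarrow>\<^sub>E (UNIV :: 'a set)"
    have "W.lincomb b B \<in> carrier ?W" by (rule W.lincomb_closed) (use BW in auto)
    then show "(W.lincomb a B = W.lincomb b B) = (a = b)"
      using ex1 ab by auto
  next
    fix a assume "a \<in> B \<rightarrow>\<^sub>E (UNIV :: 'a set)"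
    have "W.lincomb a B \<in> carrier ?W" by (rule W.lincomb_closed) (use BW in auto)
    then show "W.lincomb a B \<in> W" by simp
  next
    fix v assume "v \<in> W" then show "\<exists>a\<in>B \<rightarrow>\<^sub>E (UNIV :: 'a set). v = W.lincomb a B" using ex1 by metis
  qed
  then have "card W = card (B \<rightarrow>\<^sub>E (UNIV :: 'a set))" by (simp add: bij_betw_same_card)
  also have "\<dots> = CARD('a) ^ card B" using B(1) by (simp add: card_PiE)
  finally show ?thesis using dim by simp
qed

lemma finite_carrier_vec: "finite (carrier_vec n :: 'a::finite vec set)"
proof -
  have "carrier_vec n \<subseteq> vec_of_list ` {xs::'a list. set xs \<subseteq> UNIV \<and> length xs = n}"
  proof
    fix v :: "'a vec" assume "v \<in> carrier_vec n"
    then show "v \<in> vec_of_list ` {xs. set xs \<subseteq> UNIV \<and> length xs = n}"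
      by (intro image_eqI[of _ _ "list_of_vec v"]) (auto simp: vec_list)
  qed
  moreover have "finite {xs::'a list. set xs \<subseteq> UNIV \<and> length xs = n}"
    by (rule finite_lists_length_eq) simp
  ultimately show ?thesis by (metis finite_imageI finite_subset)
qed

lemma card_carrier_vec: "card (carrier_vec n :: 'a::{field,finite} vec set) = CARD('a) ^ n"
proof -
  interpret V: vec_space "TYPE('a)" n .
  have "card (carrier_vec n :: 'a vec set) = CARD('a) ^ subspace_dim n (carrier_vec n :: 'a vec set)"
    by (rule card_subspace) (auto simp: subspace_vec_iff finite_carrier_vec)
  moreover have "(module_vec TYPE('a) n)\<lparr>carrier := carrier_vec n\<rparr> = module_vec TYPE('a) n"
    by (simp add: module_vec_def)
  ultimately show ?thesis using V.dim_is_n by (simp add: subspace_dim_def)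
qed

lemma col_space_subspace:
  fixes A :: "'a::field mat"
  assumes "A \<in> carrier_mat m k"
  shows "VectorSpace.subspace class_ring (vec_space.col_space m A) (module_vec TYPE('a) m)"
proof -
  interpret V: vec_space "TYPE('a)" m .
  show ?thesis unfolding V.col_space_def using V.span_is_subspace assms cols_dim[of A] by auto
qed

lemma rank_full_col_space:
  fixes A :: "'a::{field,finite} mat"
  assumes A: "A \<in> carrier_mat m k" and "vec_space.rank m A = m"
  shows "vec_space.col_space m A = carrier_vec m"
proof -
  interpret V: vec_space "TYPE('a)" m .
  have sub: "V.col_space A \<subseteq> carrier_vec m"
    using col_space_subspace[OF A] by (simp add: subspace_vec_iff)
  have "subspace_dim m (V.col_space A) = m"
    using assms(2) unfolding V.rank_def subspace_dim_def V.col_space_def .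
  then have "card (V.col_space A) = CARD('a) ^ m"
    using card_subspace[OF col_space_subspace[OF A]] finite_subset[OF sub finite_carrier_vec] by simp
  then show ?thesis
    using sub finite_carrier_vec card_carrier_vec by (metis card_subset_eq)
qed

subsection \<open>Punctured and shortened codes\<close>

lemma min_dist_le:
  assumes "x \<in> C" "y \<in> C" "x \<noteq> y"
  shows "min_dist C \<le> hamming_dist x y"
  using assms unfolding min_dist_def by (auto intro: Least_le)

lemma min_dist_attained:
  assumes "min_dist C \<noteq> 0"
  obtains x y where "x \<in> C" "y \<in> C" "x \<noteq> y" "hamming_dist x y = min_dist C"
proof -
  have ex: "\<exists>x\<in>C. \<exists>y\<in>C. x \<noteq> y" using assms unfolding min_dist_def by argo
  then have "\<exists>d. \<exists>x\<in>C. \<exists>y\<in>C. x \<noteq> y \<and> hamming_dist x y = d" by auto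
  from LeastI_ex[OF this] ex have "\<exists>x\<in>C. \<exists>y\<in>C. x \<noteq> y \<and> hamming_dist x y = min_dist C"
    unfolding min_dist_def by simp
  then show ?thesis using that by blast
qed

lemma bij_betw_pick:
  assumes "finite S"
  shows "bij_betw (pick S) {..<card S} S"
proof -
  have inj: "inj_on (pick S) {..<card S}"
    by (rule linorder_inj_onI) (auto dest: pick_mono_le)
  have "pick S ` {..<card S} \<subseteq> S" by (auto intro: pick_in_set_le)
  then show ?thesis
    using inj assms card_image[OF inj] by (simp add: bij_betw_def card_subset_eq)
qed

definition restrict_vec :: "nat set \<Rightarrow> 'a vec \<Rightarrow> 'a vec" where
  "restrict_vec S c = vec (card S) (\<lambda>i. c $ pick S i)"

lemma puncture_image: "puncture C S = restrict_vec S ` C"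
  by (simp add: puncture_def restrict_vec_def)

lemma restrict_vec_eq_iff:
  assumes "finite S"
  shows "restrict_vec S x = restrict_vec S y \<longleftrightarrow> (\<forall>i\<in>S. x $ i = y $ i)"
proof -
  have "restrict_vec S x = restrict_vec S y \<longleftrightarrow> (\<forall>i\<in>{..<card S}. x $ pick S i = y $ pick S i)"
    by (auto simp: restrict_vec_def vec_eq_iff)
  also have "\<dots> \<longleftrightarrow> (\<forall>i\<in>pick S ` {..<card S}. x $ i = y $ i)" by blast
  finally show ?thesis by (simp only: bij_betw_imp_surj_on[OF bij_betw_pick[OF assms]])
qed

lemma hamming_dist_restrict_vec:
  assumes "finite S"
  shows "hamming_dist (restrict_vec S x) (restrict_vec S y) = card {i\<in>S. x $ i \<noteq> y $ i}"
proof -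
  have "bij_betw (pick S) {i\<in>{..<card S}. x $ pick S i \<noteq> y $ pick S i} {i\<in>S. x $ i \<noteq> y $ i}"
    using bij_betw_pick[OF assms] unfolding bij_betw_def inj_on_def by auto
  then have "card {i\<in>{..<card S}. x $ pick S i \<noteq> y $ pick S i} = card {i\<in>S. x $ i \<noteq> y $ i}"
    by (rule bij_betw_same_card)
  moreover have "{i. i < dim_vec (restrict_vec S x) \<and> restrict_vec S x $ i \<noteq> restrict_vec S y $ i}
      = {i\<in>{..<card S}. x $ pick S i \<noteq> y $ pick S i}"
    by (auto simp: restrict_vec_def)
  ultimately show ?thesis by (simp add: hamming_dist_def)
qed

lemma card_eq_card_image_times_card_fibre:
  assumes "finite W" and fibre: "\<And>x. x \<in> W \<Longrightarrow> card {y\<in>W. f y = f x} = m"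
  shows "card W = card (f ` W) * m"
proof -
  have "card W = (\<Sum>b\<in>f ` W. card {y\<in>W. f y = b})"
    using sum.image_gen[OF assms(1), of "\<lambda>_. 1::nat" f] by simp
  also have "\<dots> = (\<Sum>b\<in>f ` W. m)"
    by (rule sum.cong) (auto simp: fibre)
  finally show ?thesis by simp
qed

text \<open>The coordinates in \<open>T\<close> are kept as zeros, so all these codes lie in one
  space and can be compared by inclusion: for linear \<open>C\<close>,
  \<open>shortened C T \<subseteq> shortened C U\<close> says that the values of a codeword on
  \<open>T\<close> determine those on \<open>U\<close>.\<close>

definition shortened :: "'a::zero vec set \<Rightarrow> nat set \<Rightarrow> 'a vec set" where
  "shortened C T = {c\<in>C. \<forall>i\<in>T. c $ i = 0}"

lemma shortened_mono: "T \<subseteq> U \<Longrightarrow> shortened C U \<subseteq> shortened C T"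
  by (auto simp: shortened_def)

definition shortened_dim :: "nat \<Rightarrow> 'a::field vec set \<Rightarrow> nat set \<Rightarrow> nat" where
  "shortened_dim n C T = subspace_dim n (shortened C T)"

lemma one_less_card_field: "1 < CARD('a::{field,finite})"
proof -
  have "card {0, 1 :: 'a} \<le> CARD('a)" by (rule card_mono) auto
  then show ?thesis by simp
qed

section \<open>Counting dimensions of shortened codes\<close>

locale finite_linear_code =
  fixes n k :: nat and C :: "'a::{field,finite} vec set"
  assumes linear: "linear_code n k C"
begin

lemma in_carrier: "c \<in> C \<Longrightarrow> c \<in> carrier_vec n"
  and zero_in: "0\<^sub>v n \<in> C"
  and add_in: "x \<in> C \<Longrightarrow> y \<in> C \<Longrightarrow> x + y \<in> C"
  and smult_in: "x \<in> C \<Longrightarrow> a \<cdot>\<^sub>v x \<in> C"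
  using linear by (auto simp: linear_code_def subspace_vec_iff)

lemma dim_vec_code: "c \<in> C \<Longrightarrow> dim_vec c = n"
  using in_carrier by auto

lemma minus_in: "x \<in> C \<Longrightarrow> y \<in> C \<Longrightarrow> x - y \<in> C"
proof -
  assume xy: "x \<in> C" "y \<in> C"
  have "x - y = x + (- 1) \<cdot>\<^sub>v y"
    using xy by (auto intro!: eq_vecI simp: dim_vec_code)
  then show ?thesis using xy add_in smult_in by metis
qed

lemma finite_code: "finite C"
  using finite_subset[OF _ finite_carrier_vec] in_carrier by blast

lemma linear_shortened:
  assumes "T \<subseteq> {..<n}"
  shows "linear_code n (shortened_dim n C T) (shortened C T)"
  unfolding linear_code_def subspace_vec_iff shortened_dim_def shortened_def
  using assms in_carrier zero_in add_in smult_in by (auto simp: dim_vec_code subset_iff)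

lemma card_code: "card C = CARD('a) ^ k"
  using card_subspace[of C n] linear finite_code by (auto simp: linear_code_def)

lemma card_shortened:
  assumes "T \<subseteq> {..<n}"
  shows "card (shortened C T) = CARD('a) ^ shortened_dim n C T"
  using finite_linear_code.card_code[OF finite_linear_code.intro[OF linear_shortened[OF assms]]] .

lemma shortened_empty: "shortened C {} = C"
  by (simp add: shortened_def)

lemma shortened_dim_empty: "shortened_dim n C {} = k"
  using linear by (simp add: shortened_dim_def shortened_empty linear_code_def)

text \<open>The fibre through \<open>x\<close> is the translate of \<open>N\<close> by
  \<open>x\<close>, so all fibres have the size of the kernel. This is rank-nullity in
  multiplicative form.\<close>

lemma card_fibre_eq_card_kernel:
  assumes N: "N \<subseteq> C" "\<And>x y. x \<in> C \<Longrightarrow> y \<in> C \<Longrightarrow> f x = f y \<longleftrightarrow> x - y \<in> N"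
  shows "card C = card (f ` C) * card N"
proof (rule card_eq_card_image_times_card_fibre[OF finite_code])
  fix x assume x: "x \<in> C"
  have "{y\<in>C. f y = f x} = (\<lambda>z. x + z) ` N"
  proof (intro equalityI subsetI)
    fix y assume "y \<in> {y\<in>C. f y = f x}"
    moreover have "y = x + (y - x)" if "y \<in> C"
      using that x by (auto intro!: eq_vecI simp: dim_vec_code)
    ultimately show "y \<in> (\<lambda>z. x + z) ` N" using N x by blast
  next
    fix y assume "y \<in> (\<lambda>z. x + z) ` N"
    then obtain z where z: "z \<in> N" "y = x + z" by blast
    have "x + z - x = z" using z N(1) x by (auto intro!: eq_vecI simp: dim_vec_code subset_iff)
    then show "y \<in> {y\<in>C. f y = f x}" using z N x add_in by (metis (mono_tags, lifting) mem_Collect_eq subsetD)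
  qed
  moreover have "inj_on (\<lambda>z. x + z) N"
  proof (rule inj_on_inverseI)
    fix y assume "y \<in> N"
    then show "x + y - x = y"
      using N(1) x by (auto intro!: eq_vecI simp: dim_vec_code subset_iff)
  qed
  ultimately show "card {y\<in>C. f y = f x} = card N" by (simp add: card_image)
qed

text \<open>Evaluation at \<open>e\<close> maps \<open>shortened C T\<close> into the field with
  kernel \<open>shortened C (insert e T)\<close>, so the index of this kernel is at most the size of
  the field.\<close>

lemma shortened_dim_insert:
  assumes "T \<subseteq> {..<n}" "e < n"
  shows "shortened_dim n C T \<le> shortened_dim n C (insert e T) + 1"
proof -
  interpret K: finite_linear_code n "shortened_dim n C T" "shortened C T"
    by unfold_locales (rule linear_shortened[OF assms(1)])
  have "card (shortened C T) =
    card ((\<lambda>c. c $ e) ` shortened C T) * card (shortened C (insert e T))"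
  proof (rule K.card_fibre_eq_card_kernel)
    fix x y assume "x \<in> shortened C T" "y \<in> shortened C T"
    then show "x $ e = y $ e \<longleftrightarrow> x - y \<in> shortened C (insert e T)"
      using assms K.minus_in[of x y] by (auto simp: shortened_def dim_vec_code)
  qed (auto simp: shortened_def)
  also have "\<dots> \<le> CARD('a) * card (shortened C (insert e T))"
    by (rule mult_right_mono) (auto intro: card_mono)
  finally have "CARD('a) ^ shortened_dim n C T \<le> CARD('a) ^ (shortened_dim n C (insert e T) + 1)"
    using card_shortened[OF assms(1)] card_shortened[of "insert e T"] assms by simp
  then show ?thesis using one_less_card_field power_le_imp_le_exp by blast
qed

lemma shortened_dim_Un_le:
  assumes "T \<subseteq> {..<n}" "F \<subseteq> {..<n}"
  shows "shortened_dim n C T \<le> shortened_dim n C (T \<union> F) + card F"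
proof -
  have "finite F" using assms finite_subset by blast
  then show ?thesis using assms(2)
  proof (induction F rule: finite_induct)
    case (insert e F)
    then have "shortened_dim n C (T \<union> F) \<le> shortened_dim n C (insert e (T \<union> F)) + 1"
      using assms by (intro shortened_dim_insert) auto
    then show ?case using insert by simp
  qed simp
qed

lemma shortened_dim_strict_mono:
  assumes "T \<subseteq> U" "U \<subseteq> {..<n}" "\<not> shortened C T \<subseteq> shortened C U"
  shows "shortened_dim n C U < shortened_dim n C T"
proof -
  have "card (shortened C U) < card (shortened C T)"
    using finite_code assms by (intro psubset_card_mono psubsetI shortened_mono) (auto simp: shortened_def)
  then have "CARD('a) ^ shortened_dim n C U < CARD('a) ^ shortened_dim n C T"
    using card_shortened[of T] card_shortened[of U] assms by simp
  then show ?thesis by (rule power_less_imp_less_exp[OF one_less_card_field])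
qed

lemma shortened_dim_eq_0_iff:
  assumes "T \<subseteq> {..<n}"
  shows "shortened_dim n C T = 0 \<longleftrightarrow> shortened C T = {0\<^sub>v n}"
proof -
  have z: "0\<^sub>v n \<in> shortened C T" using zero_in assms by (auto simp: shortened_def)
  have "shortened_dim n C T = 0 \<longleftrightarrow> card (shortened C T) = 1"
    using card_shortened[OF assms] one_less_card_field[where 'a='a] by simp
  also have "\<dots> \<longleftrightarrow> shortened C T = {0\<^sub>v n}"
    using z by (auto simp: card_1_singleton_iff)
  finally show ?thesis .
qed

lemma obtain_nonzero_shortened:
  assumes "T \<subseteq> {..<n}" "shortened_dim n C T > 0"
  obtains c e where "c \<in> shortened C T" "c \<noteq> 0\<^sub>v n" "e < n" "c $ e \<noteq> 0"
proof -
  have z: "0\<^sub>v n \<in> shortened C T" using zero_in assms by (auto simp: shortened_def)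
  have "shortened C T \<noteq> {0\<^sub>v n}" using shortened_dim_eq_0_iff[OF assms(1)] assms(2) by simp
  then obtain c where c: "c \<in> shortened C T" "c \<noteq> 0\<^sub>v n" using z by blast
  then have "dim_vec c = n" by (simp add: shortened_def dim_vec_code)
  then have "\<exists>e<n. c $ e \<noteq> 0" using c(2) by auto
  then show ?thesis using that c by blast
qed

lemma min_dist_le_weight:
  assumes "c \<in> C" "c \<noteq> 0\<^sub>v n"
  shows "min_dist C \<le> card {i. i < n \<and> c $ i \<noteq> 0}"
proof -
  have "hamming_dist c (0\<^sub>v n) = card {i. i < n \<and> c $ i \<noteq> 0}"
    using assms by (auto simp: hamming_dist_def dim_vec_code intro!: arg_cong[of _ _ card])
  then show ?thesis using min_dist_le[OF assms(1) zero_in] assms by simp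
qed

lemma card_le_of_shortened_dim_pos:
  assumes "T \<subseteq> {..<n}" "shortened_dim n C T > 0"
  shows "card T + min_dist C \<le> n"
proof -
  obtain c where c: "c \<in> shortened C T" "c \<noteq> 0\<^sub>v n"
    using obtain_nonzero_shortened[OF assms] by metis
  then have "min_dist C \<le> card {i. i < n \<and> c $ i \<noteq> 0}"
    by (intro min_dist_le_weight) (auto simp: shortened_def)
  also have "\<dots> \<le> card ({..<n} - T)"
    using c by (intro card_mono) (auto simp: shortened_def)
  also have "\<dots> = n - card T"
    using assms by (simp add: card_Diff_subset finite_subset)
  finally show ?thesis using card_mono[OF _ assms(1)] by simp
qed

text \<open>Adding a coordinate at which a surviving codeword is nonzero lowers the dimension by
  exactly one, so \<open>card T + shortened_dim n C T\<close> is invariant. Stopping at dimension 1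
  leaves a nonzero codeword that vanishes on \<open>W\<close>.\<close>

lemma extend_to_shortened_dim_1:
  assumes "T \<subseteq> {..<n}" "shortened_dim n C T > 0"
  shows "\<exists>W. T \<subseteq> W \<and> W \<subseteq> {..<n} \<and> shortened_dim n C W = 1 \<and>
    card W + 1 = card T + shortened_dim n C T"
  using assms
proof (induction "shortened_dim n C T" arbitrary: T)
  case (Suc m)
  show ?case
  proof (cases "m = 0")
    case True
    then show ?thesis using Suc by (intro exI[of _ T]) auto
  next
    case False
    obtain c e where c: "c \<in> shortened C T" "e < n" "c $ e \<noteq> 0"
      using obtain_nonzero_shortened[OF Suc.prems] by metis
    have sub: "insert e T \<subseteq> {..<n}" using c(2) Suc.prems(1) by simp
    have "\<not> shortened C T \<subseteq> shortened C (insert e T)"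
      using c by (auto simp: shortened_def)
    then have "shortened_dim n C (insert e T) < Suc m"
      using shortened_dim_strict_mono[OF subset_insertI sub] Suc.hyps(2) by simp
    then have m: "shortened_dim n C (insert e T) = m"
      using shortened_dim_insert[OF Suc.prems(1) c(2)] Suc.hyps(2) by simp
    have "e \<notin> T" using c by (auto simp: shortened_def)
    moreover have "finite T" using Suc.prems finite_subset by blast
    ultimately have card: "card (insert e T) = card T + 1" by simp
    obtain W where "insert e T \<subseteq> W" "W \<subseteq> {..<n}" "shortened_dim n C W = 1"
      "card W + 1 = card (insert e T) + m"
      using Suc.hyps(1)[OF m[symmetric] sub] m False by auto
    then show ?thesis using card Suc.hyps(2) by (intro exI[of _ W]) auto
  qed
qed simp

text \<open>Restriction to \<open>S\<close> has kernel \<open>shortened C S\<close>; counting its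
  fibres gives the dimension of the image.\<close>

lemma puncture_linear:
  assumes "S \<subseteq> {..<n}"
  shows "linear_code (card S) (k - shortened_dim n C S) (puncture C S)"
proof -
  have fin: "finite S" using assms finite_subset by blast
  have pick: "pick S i < n" if "i < card S" for i
    using pick_in_set_le[of i S] that assms by auto
  have "restrict_vec S (0\<^sub>v n) = 0\<^sub>v (card S)"
    using pick by (auto simp: restrict_vec_def)
  then have z: "0\<^sub>v (card S) \<in> puncture C S"
    using zero_in unfolding puncture_image by (metis imageI)
  have "restrict_vec S x + restrict_vec S y = restrict_vec S (x + y)" if "x \<in> C" "y \<in> C" for x y
    using that pick by (auto simp: restrict_vec_def dim_vec_code)
  then have a: "x + y \<in> puncture C S" if "x \<in> puncture C S" "y \<in> puncture C S" for x y
    using that add_in unfolding puncture_image by auto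
  have "a \<cdot>\<^sub>v restrict_vec S x = restrict_vec S (a \<cdot>\<^sub>v x)" if "x \<in> C" for x a
    using that pick by (auto simp: restrict_vec_def dim_vec_code)
  then have s: "a \<cdot>\<^sub>v x \<in> puncture C S" if "x \<in> puncture C S" for x a
    using that smult_in unfolding puncture_image by auto
  have sub: "VectorSpace.subspace class_ring (puncture C S) (module_vec TYPE('a) (card S))"
    unfolding subspace_vec_iff using z a s by (auto simp: puncture_def)
  have "card C = card (restrict_vec S ` C) * card (shortened C S)"
  proof (rule card_fibre_eq_card_kernel)
    fix x y assume "x \<in> C" "y \<in> C"
    then show "restrict_vec S x = restrict_vec S y \<longleftrightarrow> x - y \<in> shortened C S"
      using minus_in[of x y] assms
      by (auto simp: restrict_vec_eq_iff[OF fin] shortened_def dim_vec_code subset_iff)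
  qed (auto simp: shortened_def)
  then have "CARD('a) ^ k = CARD('a) ^ (subspace_dim (card S) (puncture C S) + shortened_dim n C S)"
    using card_code card_shortened[OF assms] card_subspace[OF sub] finite_code
    by (simp add: puncture_image power_add)
  then have "k = subspace_dim (card S) (puncture C S) + shortened_dim n C S"
    using one_less_card_field power_inject_exp by blast
  then show ?thesis using sub by (simp add: linear_code_def)
qed

text \<open>Erasure correction: a codeword that vanishes on \<open>T\<close> restricts to a word on
  \<open>S\<close> of weight at most \<open>card (S - T)\<close>, which must be zero when this
  weight is below the minimum distance.\<close>

lemma shortened_subset_of_min_dist_puncture:
  assumes "S \<subseteq> {..<n}" "card (S - T) < min_dist (puncture C S)"
  shows "shortened C T \<subseteq> shortened C S"
proof
  fix c assume c: "c \<in> shortened C T"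
  have fin: "finite S" using assms finite_subset by blast
  show "c \<in> shortened C S"
  proof (rule ccontr)
    assume *: "c \<notin> shortened C S"
    then have "restrict_vec S c \<noteq> restrict_vec S (0\<^sub>v n)"
      using c assms(1) by (auto simp: restrict_vec_eq_iff[OF fin] shortened_def subset_iff)
    then have "min_dist (puncture C S) \<le> card {i\<in>S. c $ i \<noteq> 0\<^sub>v n $ i}"
      using min_dist_le[of "restrict_vec S c" "puncture C S" "restrict_vec S (0\<^sub>v n)"] c zero_in
      by (auto simp: puncture_image hamming_dist_restrict_vec[OF fin] shortened_def)
    also have "\<dots> \<le> card (S - T)"
      using c fin assms(1) by (intro card_mono) (auto simp: shortened_def subset_iff)
    finally show False using assms(2) by simp
  qed
qed

text \<open>A nonzero \<open>min_dist\<close> is attained by two codewords that differ on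
  \<open>S\<close>; their difference is a codeword that does not vanish on \<open>S\<close>.\<close>

lemma shortened_dim_less_of_min_dist_puncture:
  assumes "S \<subseteq> {..<n}" "min_dist (puncture C S) \<noteq> 0"
  shows "shortened_dim n C S < k"
proof -
  have fin: "finite S" using assms finite_subset by blast
  obtain x y where xy: "x \<in> C" "y \<in> C" "restrict_vec S x \<noteq> restrict_vec S y"
    using min_dist_attained[OF assms(2)] unfolding puncture_image by (metis imageE)
  then have "x - y \<in> shortened C {}" "x - y \<notin> shortened C S"
    using minus_in[of x y] assms(1)
    by (auto simp: restrict_vec_eq_iff[OF fin] shortened_def dim_vec_code subset_iff)
  then show ?thesis
    using shortened_dim_strict_mono[of "{}" S] assms(1) shortened_dim_empty by auto
qed

text \<open>The Singleton bound for the punctured code, with the dimension of \<open>C|\<^sub>S\<close> written as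
  \<open>k - shortened_dim n C S\<close>.\<close>

lemma min_dist_puncture_le:
  assumes "S \<subseteq> {..<n}" "shortened_dim n C S < k"
  shows "min_dist (puncture C S) + k \<le> card S + shortened_dim n C S + 1"
proof -
  have fin: "finite S" using assms finite_subset by blast
  define b where "b = k - shortened_dim n C S"
  have "k \<le> shortened_dim n C S + card S"
    using shortened_dim_Un_le[of "{}" S] assms shortened_dim_empty by simp
  \<comment> \<open>One coordinate fewer than the dimension \<open>b\<close> of the punctured code
    cannot determine its words, so some codeword vanishes on \<open>T\<close> but not on
    \<open>S\<close>.\<close>
  then have "b - 1 \<le> card S" by (simp add: b_def)
  then obtain T where T: "T \<subseteq> S" "card T = b - 1"
    by (metis obtain_subset_with_card_n)
  have "k \<le> shortened_dim n C T + card T"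
    using shortened_dim_Un_le[of "{}" T] assms T shortened_dim_empty by auto
  then have "shortened_dim n C S < shortened_dim n C T"
    using T assms(2) by (simp add: b_def)
  then have "\<not> shortened C T \<subseteq> shortened C S"
    using T shortened_mono[of T S C] by (auto simp: shortened_dim_def)
  then have "min_dist (puncture C S) \<le> card (S - T)"
    using shortened_subset_of_min_dist_puncture[OF assms(1)] not_less by blast
  also have "\<dots> = card S - card T" using T fin by (simp add: card_Diff_subset finite_subset)
  finally show ?thesis using T assms(2) \<open>b - 1 \<le> card S\<close> by (simp add: b_def)
qed

end

subsection \<open>Optimal codes with information locality\<close>

text \<open>Restriction to \<open>I\<close> is injective because only the zero word vanishes on
  \<open>I\<close>. The code and \<open>carrier_vec k\<close> have the same finite cardinality, so
  it is also onto.\<close>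

lemma (in finite_linear_code) information_set_interpolation:
  assumes "I \<subseteq> {..<n}" "card I = k" "shortened_dim n C I = 0"
  shows "\<exists>c\<in>C. \<forall>e\<in>I. c $ e = f e"
proof -
  have fin: "finite I" using assms finite_subset by blast
  have "inj_on (restrict_vec I) C"
  proof (rule inj_onI)
    fix x y assume xy: "x \<in> C" "y \<in> C" "restrict_vec I x = restrict_vec I y"
    then have "x - y \<in> shortened C I"
      using minus_in[of x y] assms(1)
      by (auto simp: restrict_vec_eq_iff[OF fin] shortened_def dim_vec_code subset_iff)
    then have "x - y = 0\<^sub>v n" using assms(1,3) shortened_dim_eq_0_iff by auto
    then have "(x - y) $ i = 0" if "i < n" for i using that by simp
    then show "x = y" using xy by (intro eq_vecI) (simp_all add: dim_vec_code)
  qed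
  then have "card (restrict_vec I ` C) = card (carrier_vec k :: 'a vec set)"
    by (simp add: card_image card_code card_carrier_vec)
  moreover have "restrict_vec I ` C \<subseteq> carrier_vec k"
    using assms(2) by (auto simp: restrict_vec_def)
  ultimately have "restrict_vec I ` C = carrier_vec k"
    by (simp add: card_subset_eq finite_carrier_vec)
  moreover have "restrict_vec I (vec n f) \<in> carrier_vec k"
    using assms(2) by (simp add: restrict_vec_def)
  ultimately obtain c where c: "c \<in> C" "restrict_vec I c = restrict_vec I (vec n f)"
    by (metis imageE)
  then have "\<forall>e\<in>I. c $ e = f e"
    using assms(1) by (auto simp: restrict_vec_eq_iff[OF fin] subset_iff)
  then show ?thesis using c(1) by blast
qed

text \<open>The hypotheses are stated through the code alone: \<open>covering\<close> replaces the
  rank condition on the columns of a generator matrix, and \<open>optimal\<close> is the distance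
  formula for \<open>k = t * r\<close>, rearranged into natural numbers.\<close>

locale optimal_lrc = finite_linear_code n k C
  for n k :: nat and C :: "'a::{field,finite} vec set" +
  fixes L :: "'i set" and S :: "'i \<Rightarrow> nat set" and r \<delta> t :: nat
  assumes r_pos: "1 \<le> r" and delta_ge: "2 \<le> \<delta>" and t_pos: "1 \<le> t" and k_eq: "k = t * r"
    and inj_S: "inj_on S L"
    and S_subset: "i \<in> L \<Longrightarrow> S i \<subseteq> {..<n}"
    and card_S_le: "i \<in> L \<Longrightarrow> card (S i) \<le> r + \<delta> - 1"
    and min_dist_S: "i \<in> L \<Longrightarrow> \<delta> \<le> min_dist (puncture C (S i))"
    and covering: "shortened_dim n C (\<Union>i\<in>L. S i) = 0"
    and optimal: "n + 1 = min_dist C + k + (t - 1) * (\<delta> - 1)"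
begin

section \<open>Rank and nullity when a local support is added\<close>

lemma finite_S: "i \<in> L \<Longrightarrow> finite (S i)"
  using S_subset finite_subset by blast

text \<open>Any \<open>\<delta> - 1\<close> coordinates of \<open>S i\<close> can be recovered from
  the rest of \<open>S i\<close>. Since \<open>U\<close> does not determine \<open>S i\<close>, at
  least \<open>\<delta>\<close> coordinates of \<open>S i\<close> lie outside \<open>U\<close>, and
  leaving out \<open>\<delta> - 1\<close> of them costs no rank. The first inequality is the gain in
  nullity, the second the bound on the gain in rank.\<close>

lemma shortened_dim_local_step:
  assumes U: "U \<subseteq> {..<n}" and i: "i \<in> L" and new: "\<not> shortened C U \<subseteq> shortened C (S i)"
  shows "card U + shortened_dim n C U + (\<delta> - 1) \<le> card (U \<union> S i) + shortened_dim n C (U \<union> S i)"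
    and "shortened_dim n C U \<le> shortened_dim n C (U \<union> S i) + r"
proof -
  have fin: "finite U" "finite (S i)" using U finite_S[OF i] finite_subset by blast+
  have "\<delta> \<le> card (S i - U)"
    using shortened_subset_of_min_dist_puncture[OF S_subset[OF i], of U] min_dist_S[OF i] new
    by (meson le_less_trans not_le order.trans)
  then obtain D where D: "D \<subseteq> S i - U" "card D = \<delta> - 1"
    by (metis obtain_subset_with_card_n diff_le_self le_trans)
  define F where "F = S i - U - D"
  have cF: "card F + (\<delta> - 1) = card (S i - U)"
    using D fin card_mono[OF _ D(1)] by (simp add: F_def card_Diff_subset finite_subset)
  have F: "F \<subseteq> {..<n}" using S_subset[OF i] by (auto simp: F_def)
  \<comment> \<open>\<open>S i - D\<close> is contained in \<open>U \<union> F\<close>, so once it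
    determines \<open>S i\<close>, adding \<open>F\<close> to \<open>U\<close> has the same effect
    as adding all of \<open>S i\<close>.\<close>
  have "S i - (S i - D) = D" using D by blast
  then have "shortened C (S i - D) \<subseteq> shortened C (S i)"
    using shortened_subset_of_min_dist_puncture[OF S_subset[OF i], of "S i - D"] min_dist_S[OF i]
      D(2) delta_ge by simp
  then have "shortened C (U \<union> F) = shortened C (U \<union> S i)"
    unfolding F_def by (auto simp: shortened_def)
  then have "shortened_dim n C U \<le> shortened_dim n C (U \<union> S i) + card F"
    using shortened_dim_Un_le[OF U F] by (simp add: shortened_dim_def)
  moreover have "card (U \<union> S i) = card U + card (S i - U)"
    using fin by (metis Un_Diff_cancel card_Un_disjoint Diff_disjoint finite_Diff)
  moreover have "card (S i - U) \<le> r + \<delta> - 1"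
    using card_S_le[OF i] card_mono[of "S i" "S i - U"] fin by auto
  ultimately show "card U + shortened_dim n C U + (\<delta> - 1)
      \<le> card (U \<union> S i) + shortened_dim n C (U \<union> S i)"
    and "shortened_dim n C U \<le> shortened_dim n C (U \<union> S i) + r"
    using cF delta_ge by simp_all
qed

lemma shortened_dim_Un_local:
  assumes "U \<subseteq> {..<n}" "i \<in> L"
  shows "shortened_dim n C U \<le> shortened_dim n C (U \<union> S i) + r"
proof (cases "shortened C U \<subseteq> shortened C (S i)")
  case True
  then have "shortened C (U \<union> S i) = shortened C U" by (auto simp: shortened_def)
  then show ?thesis by (simp add: shortened_dim_def)
qed (use shortened_dim_local_step assms in blast)

text \<open>Absorbing one local code into \<open>U\<close> loses at most \<open>r\<close> dimensions of the shortened code but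
  gains \<open>\<delta> - 1\<close> redundant coordinates; a set on which a nonzero codeword vanishes has at most
  \<open>n - d\<close> coordinates.\<close>

lemma greedy_bound:
  assumes "U \<subseteq> {..<n}" "s * r < shortened_dim n C U"
  shows "card U + shortened_dim n C U + s * (\<delta> - 1) \<le> k + (t - 1) * (\<delta> - 1)"
  using assms
proof (induction s arbitrary: U)
  \<comment> \<open>A nonzero codeword still vanishes on \<open>W\<close>, so \<open>W\<close> has
    at most \<open>n - min_dist C\<close> coordinates; \<open>optimal\<close> turns this into the
    bound.\<close>
  case 0
  then obtain W where W: "W \<subseteq> {..<n}" "shortened_dim n C W = 1"
      "card W + 1 = card U + shortened_dim n C U"
    using extend_to_shortened_dim_1[of U] by auto
  then have "card W + min_dist C \<le> n" using card_le_of_shortened_dim_pos by simp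
  then show ?case using W optimal by simp
next
  case (Suc s)
  \<comment> \<open>If no local support raised the rank of \<open>U\<close>, the codewords vanishing
    on \<open>U\<close> would vanish on every support and be zero by
    \<open>covering\<close>.\<close>
  have "\<exists>i\<in>L. \<not> shortened C U \<subseteq> shortened C (S i)"
  proof (rule ccontr)
    assume "\<not> ?thesis"
    then have "shortened C U \<subseteq> shortened C (\<Union>i\<in>L. S i)" by (auto simp: shortened_def)
    moreover have "shortened C (\<Union>i\<in>L. S i) = {0\<^sub>v n}"
      using covering S_subset by (subst shortened_dim_eq_0_iff[symmetric]) auto
    moreover have "0 < shortened_dim n C U" using Suc.prems(2) by simp
    ultimately show False using obtain_nonzero_shortened[OF Suc.prems(1)] by blast
  qed
  then obtain i where i: "i \<in> L" "\<not> shortened C U \<subseteq> shortened C (S i)" by blast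
  note step = shortened_dim_local_step[OF Suc.prems(1) i]
  have "U \<union> S i \<subseteq> {..<n}" using Suc.prems(1) S_subset[OF i(1)] by simp
  moreover have "s * r < shortened_dim n C (U \<union> S i)" using step(2) Suc.prems(2) by simp
  ultimately show ?case using Suc.IH[of "U \<union> S i"] step(1) by simp
qed

text \<open>If the rank of \<open>S i\<close> were below \<open>r\<close>, absorbing
  \<open>t - 1\<close> further local supports would push the nullity above the limit set by
  \<open>greedy_bound\<close>. With rank exactly \<open>r\<close>, a nullity of at least
  \<open>\<delta> - 1\<close> forces the maximal length.\<close>

lemma local_code_parameters:
  assumes i: "i \<in> L"
  shows "shortened_dim n C (S i) + r = k" and "card (S i) = r + \<delta> - 1"
proof -
  let ?d = "shortened_dim n C (S i)"
  \<comment> \<open>A local code is not the zero code, so \<open>S i\<close> raises the rank of the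
    empty set.\<close>
  have less: "?d < k"
    using shortened_dim_less_of_min_dist_puncture[OF S_subset[OF i]] min_dist_S[OF i] delta_ge by simp
  have "\<not> shortened C {} \<subseteq> shortened C (S i)"
  proof
    assume "shortened C {} \<subseteq> shortened C (S i)"
    then have "shortened C (S i) = shortened C {}" by (auto simp: shortened_def)
    then show False using less shortened_dim_empty by (simp add: shortened_dim_def)
  qed
  from shortened_dim_local_step[OF _ i this]
  have step: "k + (\<delta> - 1) \<le> card (S i) + ?d" "k \<le> ?d + r"
    by (simp_all add: shortened_dim_empty)
  have k: "k = (t - 1) * r + r" using k_eq t_pos by (metis add.commute le_add_diff_inverse mult_Suc plus_1_eq_Suc)
  have "\<not> (t - 1) * r < ?d"
    using greedy_bound[OF S_subset[OF i], of "t - 1"] step(1) delta_ge by auto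
  then show "?d + r = k" using step(2) k by simp
  then show "card (S i) = r + \<delta> - 1" using step(1) card_S_le[OF i] delta_ge by simp
qed

text \<open>With rank and length known, the Singleton bound caps the minimum distance at
  \<open>\<delta>\<close>.\<close>

lemma mds_puncture:
  assumes i: "i \<in> L"
  shows "mds_code (r + \<delta> - 1) r \<delta> (puncture C (S i))"
proof -
  note par = local_code_parameters[OF i]
  have "min_dist (puncture C (S i)) + k \<le> card (S i) + shortened_dim n C (S i) + 1"
    using min_dist_puncture_le[OF S_subset[OF i]] par(1) r_pos by simp
  then have "min_dist (puncture C (S i)) = \<delta>" using min_dist_S[OF i] par delta_ge by simp
  moreover have "linear_code (r + \<delta> - 1) r (puncture C (S i))"
    using puncture_linear[OF S_subset[OF i]] par by (metis diff_add_inverse)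
  ultimately show ?thesis using delta_ge by (simp add: mds_code_def)
qed

text \<open>First, \<open>S j\<close> raises the rank of \<open>S i\<close>: otherwise
  \<open>greedy_bound\<close> for \<open>s = t - 2\<close> leaves no room for a coordinate of
  \<open>S j\<close> outside \<open>S i\<close>, and the equal sizes give \<open>S i = S j\<close>,
  against injectivity. Then the union has nullity at least \<open>2 * (\<delta> - 1)\<close>, so the
  same bound forces its rank to be at least \<open>2 * r\<close>. Rank and nullity together reach
  the sum of the two sizes.\<close>

lemma disjoint_supports:
  assumes t: "2 \<le> t" and ij: "i \<in> L" "j \<in> L" "i \<noteq> j"
  shows "S i \<inter> S j = {}"
proof -
  let ?U = "S i \<union> S j"
  have U: "?U \<subseteq> {..<n}" using S_subset ij by simp
  note pi = local_code_parameters[OF ij(1)] and pj = local_code_parameters[OF ij(2)]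
  obtain t' where t': "t = t' + 2" using t by (metis add.commute le_Suc_ex)
  have k: "k = t' * r + 2 * r" using k_eq t' by (simp add: algebra_simps)
  have new: "\<not> shortened C (S i) \<subseteq> shortened C (S j)"
  proof
    assume "shortened C (S i) \<subseteq> shortened C (S j)"
    then have "shortened C ?U = shortened C (S i)" by (auto simp: shortened_def)
    then have "shortened_dim n C ?U + r = k" using pi by (simp add: shortened_dim_def)
    then have "card ?U \<le> card (S i)"
      using greedy_bound[OF U, of t'] k r_pos t' pi delta_ge by simp
    then have "?U = S i" using card_subset_eq[of ?U "S i"] card_mono[of ?U "S i"] finite_S ij by auto
    then have "S j = S i" using card_subset_eq[of "S i" "S j"] pi pj finite_S ij by auto
    then show False using inj_S ij by (auto dest: inj_onD)
  qed
  note step = shortened_dim_local_step[OF S_subset[OF ij(1)] ij(2) new]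
  have "\<not> t' * r < shortened_dim n C ?U"
    using greedy_bound[OF U, of t'] step(1) pi t' delta_ge by auto
  then have "card (S i) + card (S j) \<le> card ?U"
    using step(1) pi pj k delta_ge by simp
  then have "card (S i \<inter> S j) = 0"
    using card_Un_Int[of "S i" "S j"] finite_S ij by simp
  then show ?thesis using finite_S ij by simp
qed

section \<open>Unions of several local supports\<close>

lemma shortened_dim_UN_ge:
  assumes "finite J" "J \<subseteq> L"
  shows "k \<le> shortened_dim n C (\<Union>i\<in>J. S i) + card J * r"
  using assms
proof (induction J rule: finite_induct)
  case (insert i J)
  have "shortened_dim n C (\<Union>i\<in>J. S i) \<le> shortened_dim n C ((\<Union>i\<in>J. S i) \<union> S i) + r"
    using insert.prems S_subset by (intro shortened_dim_Un_local) auto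
  then show ?case using insert by (simp add: Un_commute)
qed (simp add: shortened_dim_empty)

lemma finite_L: "finite L"
proof -
  have "S ` L \<subseteq> Pow {..<n}" using S_subset by blast
  then show ?thesis using inj_S finite_imageD by (metis finite_Pow_iff finite_lessThan finite_subset)
qed

text \<open>Each support has rank at most \<open>r\<close> and all together have rank
  \<open>t * r\<close>, so there are enough local codes for \<open>t\<close> blocks.\<close>

lemma t_le_card_L: "t \<le> card L"
proof -
  have "t * r \<le> card L * r" using shortened_dim_UN_ge[OF finite_L] covering k_eq by simp
  then show ?thesis using r_pos by simp
qed

text \<open>Two distinct members of \<open>J\<close> force \<open>t \<ge> 2\<close>, so
  \<open>disjoint_supports\<close> applies and later arguments cover \<open>t = 1\<close> as
  well.\<close>

lemma disjoint_family_supports: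
  assumes "J \<subseteq> L" "card J \<le> t" "i \<in> J" "j \<in> J" "i \<noteq> j"
  shows "S i \<inter> S j = {}"
proof -
  have "card {i, j} \<le> card J" using assms finite_L finite_subset by (intro card_mono) auto
  then show ?thesis using assms by (intro disjoint_supports) auto
qed

text \<open>By disjointness the union has nullity at least \<open>t * (\<delta> - 1)\<close>,
  whereas a set on which a nonzero codeword vanishes has nullity at most
  \<open>(t - 1) * (\<delta> - 1)\<close>, by \<open>greedy_bound\<close> with
  \<open>s = 0\<close>.\<close>

lemma shortened_dim_UN_eq_0:
  assumes J: "J \<subseteq> L" "card J = t"
  shows "shortened_dim n C (\<Union>i\<in>J. S i) = 0"
proof (rule ccontr)
  let ?U = "\<Union>i\<in>J. S i"
  assume "shortened_dim n C ?U \<noteq> 0"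
  moreover have "?U \<subseteq> {..<n}" using J S_subset by blast
  ultimately have le: "card ?U + shortened_dim n C ?U \<le> k + (t - 1) * (\<delta> - 1)"
    using greedy_bound[of ?U 0] by simp
  have "card ?U = (\<Sum>i\<in>J. card (S i))"
    using J finite_L finite_S disjoint_family_supports[of J]
    by (intro card_UN_disjoint) (auto intro: finite_subset)
  also have "\<dots> = (\<Sum>i\<in>J. r + (\<delta> - 1))"
    using J local_code_parameters delta_ge by (intro sum.cong) auto
  also have "\<dots> = k + t * (\<delta> - 1)" using J k_eq by (simp add: algebra_simps)
  finally have "t * (\<delta> - 1) + shortened_dim n C ?U \<le> (t - 1) * (\<delta> - 1)" using le by simp
  moreover have "(t - 1) * (\<delta> - 1) \<le> t * (\<delta> - 1)" by (rule mult_le_mono1) simp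
  ultimately show False using \<open>shortened_dim n C ?U \<noteq> 0\<close> by linarith
qed

text \<open>Any \<open>r\<close> of the \<open>r + \<delta> - 1\<close> coordinates of a local
  support leave out only \<open>\<delta> - 1\<close>, which erasure correction recovers.\<close>

lemma obtain_local_information_sets:
  obtains B where "\<And>i. i \<in> L \<Longrightarrow> B i \<subseteq> S i" "\<And>i. i \<in> L \<Longrightarrow> card (B i) = r"
    "\<And>i. i \<in> L \<Longrightarrow> shortened C (B i) \<subseteq> shortened C (S i)"
proof -
  have "\<exists>B. B \<subseteq> S i \<and> card B = r \<and> shortened C B \<subseteq> shortened C (S i)" if i: "i \<in> L" for i
  proof -
    have "r \<le> card (S i)" using local_code_parameters(2)[OF i] delta_ge by simp
    then obtain B where B: "B \<subseteq> S i" "card B = r" by (metis obtain_subset_with_card_n)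
    then have "card (S i - B) < min_dist (puncture C (S i))"
      using local_code_parameters(2)[OF i] delta_ge min_dist_S[OF i] finite_S[OF i]
      by (simp add: card_Diff_subset finite_subset)
    then show ?thesis using B shortened_subset_of_min_dist_puncture[OF S_subset[OF i]] by blast
  qed
  then show ?thesis using that by metis
qed

text \<open>The sets \<open>B i\<close> inherit disjointness from the supports, so their sizes add
  up to \<open>k\<close>. They determine a word on all \<open>t\<close> supports and hence, these
  having full rank, the whole word.\<close>

lemma UN_information_sets:
  assumes J: "J \<subseteq> L" "card J = t"
    and B: "\<And>i. i \<in> J \<Longrightarrow> B i \<subseteq> S i" "\<And>i. i \<in> J \<Longrightarrow> card (B i) = r"
      "\<And>i. i \<in> J \<Longrightarrow> shortened C (B i) \<subseteq> shortened C (S i)"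
  shows "(\<Union>i\<in>J. B i) \<subseteq> {..<n}" "card (\<Union>i\<in>J. B i) = k" "shortened_dim n C (\<Union>i\<in>J. B i) = 0"
proof -
  show "(\<Union>i\<in>J. B i) \<subseteq> {..<n}" using J B(1) S_subset by blast
  have "card (\<Union>i\<in>J. B i) = (\<Sum>i\<in>J. card (B i))"
  proof (intro card_UN_disjoint ballI impI)
    show "finite J" using J finite_L finite_subset by blast
  next
    fix i assume "i \<in> J" then show "finite (B i)" using B(1) J finite_S finite_subset by (metis subsetD)
  next
    fix i j assume "i \<in> J" "j \<in> J" "i \<noteq> j"
    then show "B i \<inter> B j = {}" using disjoint_family_supports[of J i j] J B(1) by blast
  qed
  then show "card (\<Union>i\<in>J. B i) = k" using B(2) J k_eq by simp
  have "shortened C (\<Union>i\<in>J. B i) \<subseteq> shortened C (\<Union>i\<in>J. S i)"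
    using B(3) by (fastforce simp: shortened_def)
  moreover have "(\<Union>i\<in>J. B i) \<subseteq> (\<Union>i\<in>J. S i)" using B(1) by blast
  ultimately have "shortened C (\<Union>i\<in>J. B i) = shortened C (\<Union>i\<in>J. S i)"
    using shortened_mono by blast
  then show "shortened_dim n C (\<Union>i\<in>J. B i) = 0"
    using shortened_dim_UN_eq_0[OF J] by (simp add: shortened_dim_def)
qed

text \<open>This is the dual form of the independence of the column spaces: the words on the
  \<open>t\<close> supports can be prescribed independently. Interpolation fixes \<open>y\<close> on
  the local information sets, and each local code carries the values over to its whole
  support.\<close>

lemma local_extension:
  assumes J: "J \<subseteq> L" "card J = t" and j: "j \<in> J" and x: "x \<in> C"
  obtains y where "y \<in> C" "\<And>e. e \<in> S j \<Longrightarrow> y $ e = x $ e"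
    "\<And>i e. i \<in> J \<Longrightarrow> i \<noteq> j \<Longrightarrow> e \<in> S i \<Longrightarrow> y $ e = 0"
proof -
  obtain B where B: "\<And>i. i \<in> L \<Longrightarrow> B i \<subseteq> S i" "\<And>i. i \<in> L \<Longrightarrow> card (B i) = r"
    "\<And>i. i \<in> L \<Longrightarrow> shortened C (B i) \<subseteq> shortened C (S i)"
    using obtain_local_information_sets by metis
  have "\<And>i. i \<in> J \<Longrightarrow> i \<in> L" using J by blast
  note B = B[OF this]
  obtain y where y: "y \<in> C" "\<forall>e\<in>\<Union>i\<in>J. B i. y $ e = (if e \<in> S j then x $ e else 0)"
    using information_set_interpolation[OF UN_information_sets[OF J B],
        of "\<lambda>e. if e \<in> S j then x $ e else 0"] by blast
  have yB: "y $ e = (if e \<in> S j then x $ e else 0)" if "i \<in> J" "e \<in> B i" for i e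
    using y(2) that by blast
  have Sj: "e < n" if "e \<in> S j" for e using S_subset[of j] J j that by auto
  have "(y - x) $ e = 0" if "e \<in> B j" for e
  proof -
    have "e \<in> S j" using that B(1)[OF j] by blast
    then show ?thesis using yB[OF j that] Sj x by (simp add: dim_vec_code)
  qed
  then have "y - x \<in> shortened C (B j)" using minus_in[OF y(1) x] by (simp add: shortened_def)
  then have "y - x \<in> shortened C (S j)" using B(3)[OF j] by blast
  then have "(y - x) $ e = 0" if "e \<in> S j" for e using that by (simp add: shortened_def)
  then have "y $ e = x $ e" if "e \<in> S j" for e using that x Sj by (simp add: dim_vec_code)
  moreover have "y $ e = 0" if i: "i \<in> J" "i \<noteq> j" and e: "e \<in> S i" for i e
  proof -
    have "S i \<inter> S j = {}" using disjoint_family_supports[of J i j] J i j by simp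
    then have "y $ e = 0" if "e \<in> B i" for e using yB[OF i(1) that] B(1)[OF i(1)] that by auto
    then have "y \<in> shortened C (B i)" using y(1) by (simp add: shortened_def)
    then have "y \<in> shortened C (S i)" using B(3)[OF i(1)] by blast
    then show ?thesis using e by (simp add: shortened_def)
  qed
  ultimately show ?thesis using that y(1) by blast
qed

end

subsection \<open>Column spaces and generator matrices\<close>

lemma restrict_cols_carrier:
  assumes "G \<in> carrier_mat k n" "T \<subseteq> {..<n}"
  shows "restrict_cols G T \<in> carrier_mat k (card T)"
proof (rule carrier_matI)
  have "{j. j < dim_col G \<and> j \<in> T} = T" using assms by auto
  then show "dim_col (restrict_cols G T) = card T"
    unfolding restrict_cols_def dim_submatrix by (rule arg_cong)
  have "{i. i < dim_row G \<and> i \<in> UNIV} = {..<k}" using assms by auto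
  then show "dim_row (restrict_cols G T) = k"
    unfolding restrict_cols_def dim_submatrix by (simp only: card_lessThan)
qed

lemma restrict_cols_index:
  assumes "G \<in> carrier_mat k n" "T \<subseteq> {..<n}" "i < k" "j < card T"
  shows "restrict_cols G T $$ (i, j) = G $$ (i, pick T j)"
proof -
  have "{j. j < dim_col G \<and> j \<in> T} = T" "{i. i < dim_row G \<and> i \<in> UNIV} = {..<k}"
    using assms by auto
  then show ?thesis
    using submatrix_index[of i G UNIV j T] assms(3,4)
    by (simp only: restrict_cols_def pick_UNIV card_lessThan)
qed

lemma local_space_subspace:
  assumes "G \<in> carrier_mat k n" "T \<subseteq> {..<n}"
  shows "VectorSpace.subspace class_ring (local_space k G T) (module_vec TYPE('a::field) k)"
  unfolding local_space_def by (rule col_space_subspace[OF restrict_cols_carrier[OF assms]])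

lemma local_space_carrier:
  assumes "G \<in> carrier_mat k n" "T \<subseteq> {..<n}" "v \<in> local_space k G T"
  shows "v \<in> carrier_vec k"
  using local_space_subspace[OF assms(1,2)] assms(3) by (auto simp: subspace_vec_iff)

text \<open>Entry \<open>e\<close> of \<open>G\<^sup>T *\<^sub>v y\<close> is the product of
  \<open>y\<close> with column \<open>e\<close> of \<open>G\<close>. A codeword vanishing on
  \<open>T\<close> therefore comes from a message orthogonal to all columns in
  \<open>T\<close>.\<close>

lemma local_space_orthogonal:
  fixes G :: "'a::field mat"
  assumes G: "G \<in> carrier_mat k n" and T: "T \<subseteq> {..<n}" and v: "v \<in> local_space k G T"
    and y: "y \<in> carrier_vec k" and zero: "\<And>e. e \<in> T \<Longrightarrow> (G\<^sup>T *\<^sub>v y) $ e = 0"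
  shows "y \<bullet> v = 0"
proof -
  interpret V: vec_space "TYPE('a)" k .
  let ?M = "restrict_cols G T"
  note M = restrict_cols_carrier[OF G T]
  obtain x where x: "x \<in> carrier_vec (card T)" "v = ?M *\<^sub>v x"
    using v M unfolding local_space_def V.col_space_eq[OF M] by auto
  have "?M\<^sup>T *\<^sub>v y = 0\<^sub>v (card T)"
  proof (rule eq_vecI)
    fix j assume "j < dim_vec (0\<^sub>v (card T) :: 'a vec)"
    then have j: "j < card T" by simp
    then have pj: "pick T j \<in> T" "pick T j < n" using pick_in_set_le[of j T] T by auto
    have "col ?M j = col G (pick T j)"
      using M G j pj by (intro eq_vecI) (auto simp: restrict_cols_index[OF G T])
    then have "(?M\<^sup>T *\<^sub>v y) $ j = (G\<^sup>T *\<^sub>v y) $ pick T j"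
      using M G j pj by simp
    then show "(?M\<^sup>T *\<^sub>v y) $ j = 0\<^sub>v (card T) $ j" using zero[OF pj(1)] j by simp
  qed (use M in auto)
  then show ?thesis
    using transpose_vec_mult_scalar[OF M x(1) y] x by simp
qed

lemma zero_of_orthogonal_all:
  fixes v :: "'a::field vec"
  assumes "v \<in> carrier_vec k" "\<And>y. y \<in> carrier_vec k \<Longrightarrow> y \<bullet> v = 0"
  shows "v = 0\<^sub>v k"
proof (rule eq_vecI)
  fix i assume "i < dim_vec (0\<^sub>v k :: 'a vec)"
  then have i: "i < k" by simp
  have "unit_vec k i \<bullet> v = 0" by (rule assms(2)) simp
  then show "v $ i = 0\<^sub>v k $ i" using i assms(1) scalar_prod_left_unit by auto
qed (use assms in auto)

lemma code_eq_encodings: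
  assumes "generator_matrix n k C G"
  shows "C = {G\<^sup>T *\<^sub>v y | y. y \<in> carrier_vec k}"
proof -
  have G: "G \<in> carrier_mat k n" and C: "vec_space.row_space n G = C"
    using assms by (auto simp: generator_matrix_def)
  show ?thesis unfolding C[symmetric] vec_space.row_space_eq[OF G] using G by auto
qed

text \<open>Translates the rank condition into \<open>covering\<close>: the message of a codeword
  vanishing on \<open>T\<close> is orthogonal to the full space, hence zero.\<close>

lemma shortened_eq_zero_of_rank:
  fixes G :: "'a::{field,finite} mat"
  assumes gen: "generator_matrix n k C G" and T: "T \<subseteq> {..<n}"
    and rank: "vec_space.rank k (restrict_cols G T) = k"
  shows "shortened C T \<subseteq> {0\<^sub>v n}"
proof
  fix c assume c: "c \<in> shortened C T"
  have G: "G \<in> carrier_mat k n" using gen by (simp add: generator_matrix_def)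
  obtain y where y: "y \<in> carrier_vec k" "c = G\<^sup>T *\<^sub>v y"
    using c code_eq_encodings[OF gen] by (auto simp: shortened_def)
  have full: "local_space k G T = carrier_vec k"
    unfolding local_space_def by (rule rank_full_col_space[OF restrict_cols_carrier[OF G T] rank])
  have "x \<bullet> y = 0" if x: "x \<in> carrier_vec k" for x
    using local_space_orthogonal[OF G T _ y(1), of x] x y c full comm_scalar_prod[OF x y(1)]
    by (auto simp: shortened_def)
  then have "y = 0\<^sub>v k" using zero_of_orthogonal_all y(1) by blast
  moreover have "G\<^sup>T *\<^sub>v 0\<^sub>v k = 0\<^sub>v n" using G by (intro eq_vecI) auto
  ultimately show "c \<in> {0\<^sub>v n}" using y(2) by simp
qed

section \<open>Independence of the column spaces of \<open>t\<close> local codes\<close>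

context optimal_lrc
begin

text \<open>A vector \<open>v\<close> in the intersection is orthogonal to every message
  \<open>y\<close>. Indeed \<open>y\<close> splits into \<open>u\<close>, orthogonal to the first
  \<open>t - 1\<close> column spaces and so to the sum \<open>v\<close>, and \<open>y - u\<close>,
  orthogonal to the last column space, which also contains \<open>v\<close>.\<close>

lemma local_spaces_independent:
  assumes gen: "generator_matrix n k C G"
    and i: "inj_on i {1..t}" "i ` {1..t} \<subseteq> L"
  shows "local_space k G (S (i t)) \<inter>
    subspace_sum_family k (\<lambda>j. local_space k G (S (i j))) {1..t - 1} = {0\<^sub>v k}"
proof (intro equalityI subsetI)
  interpret V: vec_space "TYPE('a)" k .
  have G: "G \<in> carrier_mat k n" using gen by (simp add: generator_matrix_def)
  have iL: "i j \<in> L" if "j \<in> {1..t}" for j using i(2) that by blast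
  note Sn = S_subset[OF iL]
  have tt: "t \<in> {1..t}" using t_pos by simp
  {
    fix v assume "v \<in> local_space k G (S (i t)) \<inter>
      subspace_sum_family k (\<lambda>j. local_space k G (S (i j))) {1..t - 1}"
    then obtain w where vt: "v \<in> local_space k G (S (i t))"
      and w: "\<And>j. j \<in> {1..t - 1} \<Longrightarrow> w j \<in> local_space k G (S (i j))"
      and v: "v = finsum_vec TYPE('a) k w {1..t - 1}"
      by (auto simp: subspace_sum_family_def)
    have sub: "j \<in> {1..t} \<and> j \<noteq> t" if "j \<in> {1..t - 1}" for j using that by auto
    have wc: "w \<in> {1..t - 1} \<rightarrow> carrier_vec k"
      using w local_space_carrier[OF G Sn] sub by blast
    have vc: "v \<in> carrier_vec k" using local_space_carrier[OF G Sn[OF tt] vt] .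
    have "y \<bullet> v = 0" if y: "y \<in> carrier_vec k" for y
    proof -
      have x: "G\<^sup>T *\<^sub>v y \<in> C" using y code_eq_encodings[OF gen] by blast
      have J: "i ` {1..t} \<subseteq> L" "card (i ` {1..t}) = t" "i t \<in> i ` {1..t}"
        using i card_image[OF i(1)] tt by auto
      \<comment> \<open>\<open>z\<close> copies the codeword of \<open>y\<close> on the last support
        and vanishes on the others; its message is the \<open>u\<close> of the splitting.\<close>
      obtain z where z: "z \<in> C" "\<And>e. e \<in> S (i t) \<Longrightarrow> z $ e = (G\<^sup>T *\<^sub>v y) $ e"
        "\<And>l e. l \<in> i ` {1..t} \<Longrightarrow> l \<noteq> i t \<Longrightarrow> e \<in> S l \<Longrightarrow> z $ e = 0"
        using local_extension[OF J x] by metis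
      obtain u where u: "u \<in> carrier_vec k" "z = G\<^sup>T *\<^sub>v u"
        using z(1) code_eq_encodings[OF gen] by blast
      have "u \<bullet> w j = 0" if j: "j \<in> {1..t - 1}" for j
      proof (rule local_space_orthogonal[OF G Sn w[OF j] u(1)])
        fix e assume "e \<in> S (i j)"
        moreover have "i j \<noteq> i t" using i(1) sub[OF j] tt by (auto dest: inj_onD)
        ultimately show "(G\<^sup>T *\<^sub>v u) $ e = 0" using z(3) u(2) sub[OF j] by blast
      qed (use sub[OF j] in auto)
      then have "v \<bullet> u = 0"
        unfolding v V.finsum_vec V.finsum_scalar_prod_sum[OF wc u(1)]
        using wc comm_scalar_prod[OF _ u(1)] by (intro sum.neutral) (auto simp: Pi_iff)
      then have "u \<bullet> v = 0" using comm_scalar_prod[OF u(1) vc] by simp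
      moreover have "(y - u) \<bullet> v = 0"
      proof (rule local_space_orthogonal[OF G Sn[OF tt] vt])
        fix e assume e: "e \<in> S (i t)"
        then have "e < n" using Sn[OF tt] by auto
        moreover have "G\<^sup>T *\<^sub>v (y - u) = G\<^sup>T *\<^sub>v y - G\<^sup>T *\<^sub>v u"
          using G y u(1) by (intro mult_minus_distrib_mat_vec) auto
        ultimately show "(G\<^sup>T *\<^sub>v (y - u)) $ e = 0" using z(2)[OF e] u(2) G by simp
      qed (use y u in auto)
      moreover have "(y - u) \<bullet> v = y \<bullet> v - u \<bullet> v"
        using y u(1) vc by (rule minus_scalar_prod_distrib)
      ultimately show ?thesis by simp
    qed
    then show "v \<in> {0\<^sub>v k}" using zero_of_orthogonal_all[OF vc] by blast
  next
    fix v :: "'a vec" assume "v \<in> {0\<^sub>v k}"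
    then have v: "v = 0\<^sub>v k" by simp
    have z: "0\<^sub>v k \<in> local_space k G (S (i j))" if "j \<in> {1..t}" for j
      using local_space_subspace[OF G Sn[OF that]] by (simp add: subspace_vec_iff)
    have "finsum_vec TYPE('a) k (\<lambda>_. 0\<^sub>v k) {1..t - 1} = 0\<^sub>v k"
      by (rule eq_vecI) (simp_all add: index_finsum_vec del: V.finsum_vec, simp add: V.finsum_dim)
    then have "v \<in> subspace_sum_family k (\<lambda>j. local_space k G (S (i j))) {1..t - 1}"
      unfolding subspace_sum_family_def v using z by (intro CollectI exI[of _ "\<lambda>_. 0\<^sub>v k"]) auto
    then show "v \<in> local_space k G (S (i t)) \<inter>
        subspace_sum_family k (\<lambda>j. local_space k G (S (i j))) {1..t - 1}"
      using z[OF tt] v by simp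
  }
qed

end

lemma subspace_dim_zero: "subspace_dim n {0\<^sub>v n :: 'a::{field,finite} vec} = 0"
proof -
  have "card {0\<^sub>v n :: 'a vec} = CARD('a) ^ subspace_dim n {0\<^sub>v n :: 'a vec}"
    by (rule card_subspace) (auto simp: subspace_vec_iff)
  then have "CARD('a) ^ subspace_dim n {0\<^sub>v n :: 'a vec} = CARD('a) ^ 0" by simp
  then show ?thesis using power_inject_exp[OF one_less_card_field] by blast
qed

text \<open>The words \<open>g i\<close> are dual to the information positions \<open>E i\<close>: a
  codeword \<open>c\<close> is the combination of the \<open>g i\<close> with coefficients
  \<open>c $ E i\<close>, because the difference vanishes at all \<open>E i\<close>. This serves
  both the whole code and each local code.\<close>

lemma (in finite_linear_code) systematic_generator_matrix:
  assumes E: "\<And>i. i < k \<Longrightarrow> E i < n"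
    and g: "\<And>i. i < k \<Longrightarrow> g i \<in> C"
    and dual: "\<And>i j. i < k \<Longrightarrow> j < k \<Longrightarrow> g i $ E j = (if i = j then 1 else 0)"
    and info: "\<And>c. c \<in> C \<Longrightarrow> (\<And>i. i < k \<Longrightarrow> c $ E i = 0) \<Longrightarrow> c = 0\<^sub>v n"
  shows "generator_matrix n k C (mat k n (\<lambda>(i, j). g i $ j))"
proof -
  interpret V: vec_space "TYPE('a)" n .
  let ?M = "mat k n (\<lambda>(i, j). g i $ j)"
  have M: "?M \<in> carrier_mat k n" by simp
  have row: "row ?M i = g i" if "i < k" for i
    using that g by (intro eq_vecI) (auto simp: dim_vec_code)
  have "set (rows ?M) \<subseteq> C" using row g by (auto simp: set_conv_nth)
  then have sub: "V.row_space ?M \<subseteq> C"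
    unfolding V.row_space_def using linear
    by (intro V.span_is_subset) (auto simp: linear_code_def VectorSpace.subspace_def)
  have "C \<subseteq> V.row_space ?M"
  proof
    fix c assume c: "c \<in> C"
    let ?y = "vec k (\<lambda>i. c $ E i)"
    let ?z = "?M\<^sup>T *\<^sub>v ?y"
    have "?z \<in> carrier_vec n" by (rule carrier_vecI) simp
    then have z: "?z \<in> V.row_space ?M" unfolding V.row_space_eq[OF M] by auto
    have "?z $ E j = c $ E j" if j: "j < k" for j
    proof -
      have "?z $ E j = (\<Sum>i<k. g i $ E j * c $ E i)"
        using E[OF j] by (simp add: scalar_prod_def atLeast0LessThan)
      also have "\<dots> = (\<Sum>i<k. if i = j then c $ E i else 0)"
        using dual j by (intro sum.cong) auto
      finally show ?thesis using j by simp
    qed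
    then have "c - ?z = 0\<^sub>v n"
      using E c z sub by (intro info minus_in) (auto simp: dim_vec_code)
    then have "(c - ?z) $ i = 0" if "i < n" for i using that by simp
    then have "c = ?z" using c by (intro eq_vecI) (simp_all add: dim_vec_code)
    then show "c \<in> V.row_space ?M" using z by simp
  qed
  then show ?thesis using sub linear M by (auto simp: generator_matrix_def)
qed

section \<open>Column arrangements and block-diagonal matrices\<close>

lemma extend_to_permutation:
  fixes f :: "nat \<Rightarrow> nat"
  assumes inj: "inj_on f {..<m}" and im: "f ` {..<m} \<subseteq> {..<n}"
  obtains p where "p permutes {..<n}" "\<And>q. q < m \<Longrightarrow> p q = f q"
proof -
  have mn: "m \<le> n" using card_inj_on_le[OF inj im] by simp
  have "card ({..<n} - f ` {..<m}) = card {m..<n}"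
    using im card_image[OF inj] by (simp add: card_Diff_subset)
  then obtain h where h: "bij_betw h {m..<n} ({..<n} - f ` {..<m})"
    using finite_same_card_bij[of "{m..<n}" "{..<n} - f ` {..<m}"] by auto
  define p where "p x = (if x < m then f x else if x < n then h x else x)" for x
  have "bij_betw p {..<m} (f ` {..<m})"
    using inj by (auto simp: bij_betw_def p_def inj_on_def)
  moreover have "bij_betw p {m..<n} ({..<n} - f ` {..<m})"
    using h by (subst bij_betw_cong[of _ _ h]) (auto simp: p_def)
  ultimately have "bij_betw p ({..<m} \<union> {m..<n}) (f ` {..<m} \<union> ({..<n} - f ` {..<m}))"
    by (rule bij_betw_combine) auto
  moreover have "{..<m} \<union> {m..<n} = {..<n}" "f ` {..<m} \<union> ({..<n} - f ` {..<m}) = {..<n}"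
    using mn im by auto
  ultimately have "p permutes {..<n}"
    using mn by (intro bij_imp_permutes) (auto simp: p_def)
  then show ?thesis using that by (auto simp: p_def)
qed

text \<open>For blocks of equal size, quotient and remainder of an index name the block and the
  position inside it. One induction proves both claims, since the entry formula needs the dimensions
  of the tail.\<close>

lemma diag_block_mat_uniform:
  assumes "\<And>A. A \<in> set As \<Longrightarrow> A \<in> carrier_mat r m"
  shows "diag_block_mat As \<in> carrier_mat (length As * r) (length As * m)"
    and "i < length As * r \<Longrightarrow> j < length As * m \<Longrightarrow> diag_block_mat As $$ (i, j) =
      (if i div r = j div m then (As ! (i div r)) $$ (i mod r, j mod m) else 0)"
proof -
  have "diag_block_mat As \<in> carrier_mat (length As * r) (length As * m) \<and>
    (\<forall>i j. i < length As * r \<longrightarrow> j < length As * m \<longrightarrow> diag_block_mat As $$ (i, j) =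
      (if i div r = j div m then (As ! (i div r)) $$ (i mod r, j mod m) else 0))"
    using assms
  proof (induction As)
    case (Cons A As)
    then have A: "A \<in> carrier_mat r m"
      and D: "diag_block_mat As \<in> carrier_mat (length As * r) (length As * m)"
      and IH: "\<And>i j. i < length As * r \<Longrightarrow> j < length As * m \<Longrightarrow> diag_block_mat As $$ (i, j) =
        (if i div r = j div m then (As ! (i div r)) $$ (i mod r, j mod m) else 0)"
      by auto
    have "diag_block_mat (A # As) $$ (i, j) =
        (if i div r = j div m then ((A # As) ! (i div r)) $$ (i mod r, j mod m) else 0)"
      if i: "i < length (A # As) * r" and j: "j < length (A # As) * m" for i j
    proof -
      have pos: "r > 0" "m > 0" using i j by (auto intro: Nat.gr0I)
      have di: "i div r = Suc ((i - r) div r)" "i mod r = (i - r) mod r" if "\<not> i < r"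
        using that pos by (simp_all add: le_div_geq le_mod_geq)
      have dj: "j div m = Suc ((j - m) div m)" "j mod m = (j - m) mod m" if "\<not> j < m"
        using that pos by (simp_all add: le_div_geq le_mod_geq)
      show ?thesis
        using A D IH[of "i - r" "j - m"] i j di dj by (cases "i < r"; cases "j < m") (auto simp: Let_def)
    qed
    then show ?case using A D by (auto simp: Let_def)
  qed auto
  then show "diag_block_mat As \<in> carrier_mat (length As * r) (length As * m)"
    and "i < length As * r \<Longrightarrow> j < length As * m \<Longrightarrow> diag_block_mat As $$ (i, j) =
      (if i div r = j div m then (As ! (i div r)) $$ (i mod r, j mod m) else 0)"
    by auto
qed

section \<open>Block form of a generator matrix\<close>

context optimal_lrc
begin

text \<open>The block form is reached by passing to the basis of \<open>C\<close> dual to the union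
  of \<open>t\<close> local information sets. A basis word belonging to one support vanishes on the
  information sets of the others and hence on those supports, which gives the zero blocks.\<close>

lemma block_form:
  assumes js: "distinct js" "length js = t" "set js \<subseteq> L"
  shows "\<exists>G' p Gs A.
    generator_matrix n k C G' \<and> p permutes {..<n} \<and> length Gs = t \<and>
    (\<forall>M\<in>set Gs. \<exists>D. mds_code (r + \<delta> - 1) r \<delta> D \<and> generator_matrix (r + \<delta> - 1) r D M) \<and>
    A \<in> carrier_mat k (n - t * (r + \<delta> - 1)) \<and>
    permute_cols p G' = append_cols (diag_block_mat Gs) A"
proof -
  define m where "m = r + \<delta> - 1"
  have m_pos: "0 < m" using delta_ge by (simp add: m_def)
  define T where "T a = S (js ! a)" for a
  have jsL: "js ! a \<in> L" if "a < t" for a using js that by auto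
  obtain B' where B': "\<And>i. i \<in> L \<Longrightarrow> B' i \<subseteq> S i" "\<And>i. i \<in> L \<Longrightarrow> card (B' i) = r"
    "\<And>i. i \<in> L \<Longrightarrow> shortened C (B' i) \<subseteq> shortened C (S i)"
    using obtain_local_information_sets by metis
  define B where "B a = B' (js ! a)" for a
  note B'J = B'[OF subsetD[OF js(3)]]
  have BT: "B a \<subseteq> T a" and cB: "card (B a) = r"
    and KB: "shortened C (B a) \<subseteq> shortened C (T a)" and T_sub: "T a \<subseteq> {..<n}"
    and cT: "card (T a) = m" if "a < t" for a
    using B'[OF jsL[OF that]] S_subset[OF jsL[OF that]] local_code_parameters(2)[OF jsL[OF that]]
    by (simp_all add: B_def T_def m_def)
  have finT: "finite (T a)" if "a < t" for a using T_sub[OF that] finite_subset by blast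
  have cJ: "card (set js) = t" using js by (simp add: distinct_card)
  have disj: "T a \<inter> T b = {}" if "a < t" "b < t" "a \<noteq> b" for a b
    using disjoint_family_supports[OF js(3)] that js cJ
    by (simp add: T_def nth_eq_iff_index_eq)
  have div_mod: "i div r < t" "i mod r < r" if "i < k" for i
    using that k_eq r_pos by (simp_all add: less_mult_imp_div_less)
  \<comment> \<open>\<open>E\<close> lists the information positions block by block:
    \<open>E (a * r + b)\<close> is position \<open>b\<close> of \<open>B a\<close>.\<close>
  define E where "E i = pick (B (i div r)) (i mod r)" for i
  define I where "I = (\<Union>i\<in>set js. B' i)"
  have I_eq: "I = (\<Union>a<t. B a)"
    using js(2) by (force simp: I_def B_def in_set_conv_nth)
  have info: "I \<subseteq> {..<n}" "card I = k" "shortened_dim n C I = 0"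
    unfolding I_def using UN_information_sets[OF js(3) cJ B'J] by simp_all
  have E_B: "E i \<in> B (i div r)" if "i < k" for i
    using pick_in_set_le[of "i mod r" "B (i div r)"] cB[OF div_mod(1)[OF that]] div_mod(2)[OF that]
    by (simp add: E_def)
  have E_block: "E (a * r + b) = pick (B a) b" if "b < r" for a b
    using that by (simp add: E_def)
  have block_less: "a * r + b < k" if "a < t" "b < r" for a b
  proof -
    have "a * r + b < Suc a * r" using that by simp
    also have "\<dots> \<le> t * r" using that by (intro mult_le_mono1) simp
    finally show ?thesis using k_eq by simp
  qed
  have E_surj: "\<exists>b<r. e = E (a * r + b)" if "a < t" "e \<in> B a" for a e
  proof -
    have "finite (B a)" using BT[OF that(1)] finT[OF that(1)] finite_subset by blast
    then have "e \<in> pick (B a) ` {..<r}"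
      using bij_betw_imp_surj_on[OF bij_betw_pick[of "B a"]] cB[OF that(1)] that(2) by simp
    then show ?thesis using E_block by force
  qed
  have "E ` {..<k} = I"
  proof (intro equalityI subsetI)
    fix e assume "e \<in> E ` {..<k}"
    then show "e \<in> I" using E_B div_mod(1) unfolding I_eq by blast
  next
    fix e assume "e \<in> I"
    then obtain a where a: "a < t" "e \<in> B a" unfolding I_eq by blast
    obtain b where "b < r" "e = E (a * r + b)" using E_surj[OF a] by blast
    then show "e \<in> E ` {..<k}" using block_less[OF a(1)] by blast
  qed
  \<comment> \<open>A surjection between sets of the same finite size is injective.\<close>
  then have E_inj: "inj_on E {..<k}" using info(2) by (intro eq_card_imp_inj_on) simp_all
  have "\<exists>c\<in>C. \<forall>e\<in>I. c $ e = (if e = E i then 1 else 0)" for i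
    by (rule information_set_interpolation[OF info])
  then obtain g where g: "\<And>i. g i \<in> C" "\<And>i e. e \<in> I \<Longrightarrow> g i $ e = (if e = E i then 1 else 0)"
    by metis
  have E_I: "E i \<in> I" if "i < k" for i using that \<open>E ` {..<k} = I\<close> by blast
  have dual: "g i $ E j = (if i = j then 1 else 0)" if "i < k" "j < k" for i j
    using g(2)[OF E_I[OF that(2)], of i] E_inj that by (auto dest: inj_onD)
  have off: "g i $ e = 0" if i: "i < k" and a: "a < t" "a \<noteq> i div r" and e: "e \<in> T a" for i a e
  proof -
    have "g i $ x = 0" if "x \<in> B a" for x
    proof -
      have "x \<noteq> E i"
        using disj[OF a(1) div_mod(1)[OF i] a(2)] E_B[OF i] BT[OF a(1)] BT[OF div_mod(1)[OF i]] that
        by blast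
      then show ?thesis using g(2)[of x i] a(1) that unfolding I_eq by auto
    qed
    then have "g i \<in> shortened C (B a)" using g(1) by (simp add: shortened_def)
    then show ?thesis using KB[OF a(1)] e by (auto simp: shortened_def)
  qed
  define G' where "G' = mat k n (\<lambda>(i, j). g i $ j)"
  have G'_gen: "generator_matrix n k C G'"
    unfolding G'_def
  proof (rule systematic_generator_matrix[OF _ g(1) dual])
    fix i assume "i < k" then show "E i < n" using E_I info(1) by blast
  next
    fix c assume c: "c \<in> C" and z: "\<And>i. i < k \<Longrightarrow> c $ E i = 0"
    then have "c \<in> shortened C I" using \<open>E ` {..<k} = I\<close> by (auto simp: shortened_def)
    then show "c = 0\<^sub>v n" using info shortened_dim_eq_0_iff by auto
  qed
  define M where "M a = mat r m (\<lambda>(b, c). g (a * r + b) $ pick (T a) c)" for a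
  have M_gen: "mds_code m r \<delta> (puncture C (T a)) \<and> generator_matrix m r (puncture C (T a)) (M a)"
    if a: "a < t" for a
  proof
    show mds: "mds_code m r \<delta> (puncture C (T a))"
      unfolding m_def T_def by (rule mds_puncture[OF jsL[OF a]])
    interpret D: finite_linear_code m r "puncture C (T a)"
      using mds by unfold_locales (simp add: mds_code_def)
    \<comment> \<open>Puncturing renumbers the coordinates; \<open>pos b\<close> is the number that
      information position \<open>b\<close> of \<open>B a\<close> receives inside
      \<open>T a\<close>.\<close>
    define pos where "pos b = card {x\<in>T a. x < pick (B a) b}" for b
    have pB: "pick (B a) b \<in> T a" if "b < r" for b
      using pick_in_set_le[of b "B a"] cB[OF a] BT[OF a] that by auto
    have pick_pos: "pick (T a) (pos b) = E (a * r + b)" and pos_less: "pos b < m" if "b < r" for b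
    proof -
      show "pick (T a) (pos b) = E (a * r + b)"
        unfolding pos_def pick_card_in_set[OF pB[OF that]] E_block[OF that] ..
      have "{x\<in>T a. x < pick (B a) b} \<subset> T a" using pB[OF that] by blast
      then show "pos b < m" unfolding pos_def using psubset_card_mono[OF finT[OF a]] cT[OF a] by simp
    qed
    have "generator_matrix m r (puncture C (T a))
        (mat r m (\<lambda>(b, c). restrict_vec (T a) (g (a * r + b)) $ c))"
    proof (rule D.systematic_generator_matrix[OF pos_less])
      fix b show "restrict_vec (T a) (g (a * r + b)) \<in> puncture C (T a)"
        using g(1) by (simp add: puncture_image)
    next
      fix b b' assume b: "b < r" "b' < r"
      have "restrict_vec (T a) (g (a * r + b)) $ pos b' = g (a * r + b) $ E (a * r + b')"
        using pos_less[OF b(2)] pick_pos[OF b(2)] cT[OF a] by (simp add: restrict_vec_def)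
      then show "restrict_vec (T a) (g (a * r + b)) $ pos b' = (if b = b' then 1 else 0)"
        using dual[OF block_less[OF a b(1)] block_less[OF a b(2)]] by simp
    next
      fix d assume d: "d \<in> puncture C (T a)" and z: "\<And>b. b < r \<Longrightarrow> d $ pos b = 0"
      obtain c where c: "c \<in> C" "d = restrict_vec (T a) c" using d by (auto simp: puncture_image)
      have "c $ e = 0" if e: "e \<in> B a" for e
      proof -
        obtain b where b: "b < r" "e = E (a * r + b)" using E_surj[OF a e] by blast
        then show ?thesis
          using z[OF b(1)] pick_pos[OF b(1)] pos_less[OF b(1)] cT[OF a] c(2)
          by (simp add: restrict_vec_def)
      qed
      then have "c \<in> shortened C (T a)" using c(1) KB[OF a] by (auto simp: shortened_def)
      then have "\<forall>e\<in>T a. c $ e = 0" by (simp add: shortened_def)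
      then show "d = 0\<^sub>v m"
        unfolding c(2) restrict_vec_def cT[OF a]
        using pick_in_set_le[of _ "T a"] cT[OF a] by (intro eq_vecI) auto
    qed
    moreover have "mat r m (\<lambda>(b, c). restrict_vec (T a) (g (a * r + b)) $ c) = M a"
      unfolding M_def using cT[OF a] by (intro eq_matI) (auto simp: restrict_vec_def)
    ultimately show "generator_matrix m r (puncture C (T a)) (M a)" by simp
  qed
  define Gs where "Gs = map M [0..<t]"
  have Gs_carrier: "X \<in> carrier_mat r m" if "X \<in> set Gs" for X
    using that by (auto simp: Gs_def M_def)
  \<comment> \<open>Column \<open>q\<close> of the block layout is coordinate \<open>f q\<close> of
    the code. The permutation \<open>p\<close> extends \<open>f\<close> beyond the blocks, and
    \<open>A\<close> collects the remaining columns.\<close>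
  define f where "f q = pick (T (q div m)) (q mod m)" for q
  have q_div: "q div m < t" "q mod m < m" if "q < t * m" for q
    using that m_pos by (simp_all add: less_mult_imp_div_less)
  have f_T: "f q \<in> T (q div m)" if "q < t * m" for q
    using pick_in_set_le[of "q mod m" "T (q div m)"] cT[OF q_div(1)[OF that]] q_div(2)[OF that]
    by (simp add: f_def)
  have f_im: "f ` {..<t * m} \<subseteq> {..<n}"
    using f_T T_sub q_div(1) by blast
  have f_inj: "inj_on f {..<t * m}"
  proof (rule inj_onI)
    fix x y assume "x \<in> {..<t * m}" "y \<in> {..<t * m}" and eq: "f x = f y"
    then have x: "x < t * m" and y: "y < t * m" by auto
    have d: "x div m = y div m"
      using disj[OF q_div(1)[OF x] q_div(1)[OF y]] f_T[OF x] f_T[OF y] eq by auto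
    have "x mod m = y mod m"
      using bij_betw_imp_inj_on[OF bij_betw_pick[OF finT[OF q_div(1)[OF x]]]]
        q_div(2)[OF x] q_div(2)[OF y] eq d cT[OF q_div(1)[OF x]]
      by (auto simp: f_def inj_on_def)
    then show "x = y" using d by (metis div_mult_mod_eq)
  qed
  obtain p where p: "p permutes {..<n}" "\<And>q. q < t * m \<Longrightarrow> p q = f q"
    using extend_to_permutation[OF f_inj f_im] by metis
  have tm: "t * m \<le> n" using card_inj_on_le[OF f_inj f_im] by simp
  have p_less: "p q < n" if "q < n" for q using permutes_in_image[OF p(1), of q] that by simp
  define A where "A = mat k (n - t * m) (\<lambda>(i, j). G' $$ (i, p (t * m + j)))"
  have diag: "diag_block_mat Gs \<in> carrier_mat k (t * m)"
    using diag_block_mat_uniform(1)[of Gs, OF Gs_carrier] k_eq by (simp add: Gs_def)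
  have diag_index: "diag_block_mat Gs $$ (i, q) = g i $ f q" if i: "i < k" and q: "q < t * m" for i q
  proof -
    have "diag_block_mat Gs $$ (i, q) =
        (if i div r = q div m then (Gs ! (i div r)) $$ (i mod r, q mod m) else 0)"
      using diag_block_mat_uniform(2)[of Gs r m i q, OF Gs_carrier] i q k_eq by (simp add: Gs_def)
    also have "\<dots> = g i $ f q"
    proof (cases "i div r = q div m")
      case True
      have "(Gs ! (i div r)) $$ (i mod r, q mod m) = M (i div r) $$ (i mod r, q mod m)"
        using div_mod(1)[OF i] by (simp add: Gs_def)
      also have "\<dots> = g (i div r * r + i mod r) $ pick (T (i div r)) (q mod m)"
        using div_mod(2)[OF i] q_div(2)[OF q] by (simp add: M_def)
      also have "\<dots> = g i $ pick (T (i div r)) (q mod m)" by (simp only: div_mult_mod_eq)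
      finally show ?thesis using True by (simp add: f_def)
    next
      case False
      then show ?thesis using off[OF i q_div(1)[OF q] _ f_T[OF q]] by simp
    qed
    finally show ?thesis .
  qed
  have "permute_cols p G' = append_cols (diag_block_mat Gs) A"
  proof (rule eq_matI)
    fix i q assume "i < dim_row (append_cols (diag_block_mat Gs) A)"
      "q < dim_col (append_cols (diag_block_mat Gs) A)"
    then have i: "i < k" and q: "q < n"
      using diag tm by (simp_all add: append_cols_def A_def)
    have "permute_cols p G' $$ (i, q) = g i $ p q"
      using i q p_less[OF q] by (simp add: permute_cols_def G'_def)
    also have "\<dots> = append_cols (diag_block_mat Gs) A $$ (i, q)"
      using diag_index[OF i, of q] p(2)[of q] i q diag tm p_less[OF q]
      by (simp add: append_cols_def A_def G'_def)
    finally show "permute_cols p G' $$ (i, q) = append_cols (diag_block_mat Gs) A $$ (i, q)" .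
  qed (use diag tm in \<open>simp_all add: permute_cols_def append_cols_def G'_def A_def\<close>)
  moreover have "\<forall>X\<in>set Gs. \<exists>D. mds_code m r \<delta> D \<and> generator_matrix m r D X"
  proof
    fix X assume "X \<in> set Gs"
    then obtain a where "a < t" "X = M a" by (auto simp: Gs_def)
    then show "\<exists>D. mds_code m r \<delta> D \<and> generator_matrix m r D X" using M_gen by blast
  qed
  ultimately show ?thesis
    using G'_gen p(1)
    unfolding m_def[symmetric]
    by (intro exI[of _ G'] exI[of _ p] exI[of _ Gs] exI[of _ A]) (simp add: Gs_def A_def)
qed

end

section \<open>The zero code and the final assembly\<close>

lemma min_dist_zero_code:
  fixes C :: "'a::{field,finite} vec set"
  assumes "linear_code n 0 C"
  shows "min_dist C = 0"
proof (rule ccontr)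
  interpret finite_linear_code n 0 C by unfold_locales (rule assms)
  assume "min_dist C \<noteq> 0"
  then obtain x y where "x \<in> C" "y \<in> C" "x \<noteq> y" using min_dist_attained by metis
  moreover have "card C = 1" using card_code by simp
  ultimately show False by (auto simp: card_1_singleton_iff)
qed

text \<open>For \<open>r = k\<close> an optimal code is MDS. If it is longer than
  \<open>r + \<delta> - 1\<close>, any \<open>r + \<delta> - 1\<close> of its coordinates form a
  local support, and distinct supports can overlap; hence the condition \<open>r < k\<close> in the
  disjointness clause.\<close>

theorem mainTheorem2:
  fixes C :: "'a::{field,finite} vec set" and G :: "'a mat"
    and L :: "'i set" and S :: "'i \<Rightarrow> nat set"
    and n k r \<delta> t :: nat
  assumes "r \<ge> 1" and "\<delta> \<ge> 2" and "r dvd k" and "t = k div r"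
    and "linear_code n k C"
    and "generator_matrix n k C G"
    and "info_locality_family n k r \<delta> C G L S"
    and "optimal_distance n k r \<delta> (min_dist C)"
  shows "(\<forall>i\<in>L. mds_code (r + \<delta> - 1) r \<delta> (puncture C (S i))) \<and>
    (r < k \<longrightarrow> (\<forall>i\<in>L. \<forall>j\<in>L. i \<noteq> j \<longrightarrow> S i \<inter> S j = {})) \<and>
    (\<forall>i :: nat \<Rightarrow> 'i. inj_on i {1..t} \<and> i ` {1..t} \<subseteq> L \<longrightarrow>
       subspace_dim k
         (local_space k G (S (i t)) \<inter>
          subspace_sum_family k (\<lambda>j. local_space k G (S (i j))) {1..t - 1}) = 0) \<and>
    (\<exists>G' p Gs A.
       generator_matrix n k C G' \<and> p permutes {..<n} \<and>
       length Gs = t \<and>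
       (\<forall>M\<in>set Gs. \<exists>D. mds_code (r + \<delta> - 1) r \<delta> D \<and> generator_matrix (r + \<delta> - 1) r D M) \<and>
       A \<in> carrier_mat k (n - t * (r + \<delta> - 1)) \<and>
       permute_cols p G' = append_cols (diag_block_mat Gs) A)"
proof -
  have k: "k = t * r" using assms(3,4) by simp
  \<comment> \<open>For \<open>k = 0\<close> the convention gives the zero code minimum distance 0,
    while the optimal distance would be \<open>n + \<delta>\<close>.\<close>
  have t_pos: "1 \<le> t"
  proof (rule ccontr)
    assume "\<not> 1 \<le> t"
    then have "k = 0" using k by simp
    then have "min_dist C = 0" using min_dist_zero_code assms(5) by blast
    then show False using \<open>k = 0\<close> assms(2,8) by (simp add: optimal_distance_def)
  qed
  have "\<lceil>real k / real r\<rceil> = int t" using k assms(1) by simp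
  then have "int (min_dist C) = int n - int k + 1 - (int t - 1) * (int \<delta> - 1)"
    using assms(8) by (simp add: optimal_distance_def)
  moreover have "int ((t - 1) * (\<delta> - 1)) = (int t - 1) * (int \<delta> - 1)"
    using t_pos assms(2) by (simp add: of_nat_diff)
  ultimately have opt: "n + 1 = min_dist C + k + (t - 1) * (\<delta> - 1)" by linarith
  have fam: "inj_on S L" "\<And>i. i \<in> L \<Longrightarrow> S i \<subseteq> {..<n}" "\<And>i. i \<in> L \<Longrightarrow> card (S i) \<le> r + \<delta> - 1"
    "\<And>i. i \<in> L \<Longrightarrow> \<delta> \<le> min_dist (puncture C (S i))"
    "vec_space.rank k (restrict_cols G (\<Union>i\<in>L. S i)) = k"
    using assms(7) by (auto simp: info_locality_family_def)
  interpret finite_linear_code n k C by unfold_locales (rule assms(5))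
  have US: "(\<Union>i\<in>L. S i) \<subseteq> {..<n}" using fam(2) by blast
  have "0\<^sub>v n \<in> shortened C (\<Union>i\<in>L. S i)" using zero_in US by (auto simp: shortened_def)
  then have "shortened_dim n C (\<Union>i\<in>L. S i) = 0"
    using shortened_eq_zero_of_rank[OF assms(6) US fam(5)] shortened_dim_eq_0_iff[OF US] by blast
  then interpret optimal_lrc n k C L S r \<delta> t
    using fam assms(1,2) k t_pos opt by unfold_locales
  obtain J where "J \<subseteq> L" "card J = t"
    using t_le_card_L by (metis obtain_subset_with_card_n)
  then obtain js where js: "distinct js" "length js = t" "set js \<subseteq> L"
    using finite_distinct_list[of J] finite_L finite_subset by (metis distinct_card)
  have "S i \<inter> S j = {}" if "r < k" "i \<in> L" "j \<in> L" "i \<noteq> j" for i j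
  proof (rule disjoint_supports[OF _ that(2-4)])
    show "2 \<le> t" using that(1) k t_pos by (cases "t = 1") auto
  qed
  then show ?thesis
    using mds_puncture local_spaces_independent[OF assms(6)] subspace_dim_zero[where 'a='a]
      block_form[OF js]
    by simp
qed

end
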